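(* For every word-hyperbolic group $\Gamma$, $H^i_{(\infty)}(\Gamma;\mathbb{Z})=0$ for all $i>1$.
   Context: Norm on an abelian group $A$: a function $|\cdot|:A\to\mathbb{R}_{\ge 0}$ with $|a|=0$ iff $a=0$, $|a|=|-a|$, and $|a+b|\le|a|+|b|$. For a CW complex $X$ and a normed abelian group $A$, let $E_n(X)$ be the set of $n$-cells and $C^n(X;A)=\operatorname{Hom}(\bigoplus_{E_n(X)}\mathbb{Z},A)$ the cellular $n$-cochains. The bounded cochains $C^n_{(\infty)}(X;A)\subset C^n(X;A)$ are those $\phi$ for which there is $b$ with $|\phi(e)|\le b$ for all $e\in E_n(X)$; they form a subcomplex under the cellular coboundary, and its cohomology is the $\ell_\infty$-cohomology $H^*_{(\infty)}(X;A)$ (for finitely generated $A$ it does not depend on the choice of norm). For a group $\Gamma$ admitting a $K(\Gamma,1)$ all of whose skeleta are finite complexes, $H^i_{(\infty)}(\Gamma;A):=H^i_{(\infty)}(X;A)$ where $X$ is the universal cover of such a $K(\Gamma,1)$ with the lifted CW structure (this is independent of the choice of such $K(\Gamma,1)$); hyperbolic groups admit such a $K(\Gamma,1)$. *)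

theory Defs
  imports Complex_Main "HOL-Algebra.Group" "HOL-Algebra.Generated_Groups"
begin

definition word_length :: "'g monoid \<Rightarrow> 'g set \<Rightarrow> 'g \<Rightarrow> nat" where
  "word_length G S x =
     (LEAST n. \<exists>ws. length ws = n \<and> set ws \<subseteq> S \<union> m_inv G ` S \<and>
                   foldr (\<otimes>\<^bsub>G\<^esub>) ws \<one>\<^bsub>G\<^esub> = x)"

definition word_dist :: "'g monoid \<Rightarrow> 'g set \<Rightarrow> 'g \<Rightarrow> 'g \<Rightarrow> real" where
  "word_dist G S x y = real (word_length G S (inv\<^bsub>G\<^esub> x \<otimes>\<^bsub>G\<^esub> y))"

definition gromov_product :: "'g monoid \<Rightarrow> 'g set \<Rightarrow> 'g \<Rightarrow> 'g \<Rightarrow> 'g \<Rightarrow> real" where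
  "gromov_product G S w x y =
     (word_dist G S x w + word_dist G S y w - word_dist G S x y) / 2"

definition hyperbolic_group :: "'g monoid \<Rightarrow> bool" where
  "hyperbolic_group G \<longleftrightarrow> group G \<and>
     (\<exists>S \<delta>. finite S \<and> S \<subseteq> carrier G \<and> generate G S = carrier G \<and> \<delta> \<ge> 0 \<and>
        (\<forall>w\<in>carrier G. \<forall>x\<in>carrier G. \<forall>y\<in>carrier G. \<forall>z\<in>carrier G.
           gromov_product G S w x z \<ge>
             min (gromov_product G S w x y) (gromov_product G S w y z) - \<delta>))"

section \<open>Free ZG-resolutions of finite type (cellular chains of universal covers)\<close>

text \<open>The n-th chain group is the free ZG-module with basis e_0..e_{r-1}; its
Z-basis consists of the "cells" g e_i, encoded as pairs (g,i). A chain is a finitely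
supported integer function on cells.\<close>
definition chains :: "'g monoid \<Rightarrow> nat \<Rightarrow> ('g \<times> nat \<Rightarrow> int) set" where
  "chains G r = {f. finite {c. f c \<noteq> 0} \<and>
                    (\<forall>g i. f (g, i) \<noteq> 0 \<longrightarrow> g \<in> carrier G \<and> i < r)}"

definition translate :: "'g monoid \<Rightarrow> 'g \<Rightarrow> ('g \<times> nat \<Rightarrow> int) \<Rightarrow> ('g \<times> nat \<Rightarrow> int)" where
  "translate G g f = (\<lambda>(h, i). if h \<in> carrier G then f (inv\<^bsub>G\<^esub> g \<otimes>\<^bsub>G\<^esub> h, i) else 0)"

definition bdry :: "'g monoid \<Rightarrow> (nat \<Rightarrow> ('g \<times> nat \<Rightarrow> int)) \<Rightarrow> ('g \<times> nat \<Rightarrow> int) \<Rightarrow> ('g \<times> nat \<Rightarrow> int)" where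
  "bdry G b f = (\<lambda>x. \<Sum>c\<in>{c. f c \<noteq> 0}. f c * translate G (fst c) (b (snd c)) x)"

definition aug :: "(nat \<Rightarrow> int) \<Rightarrow> ('g \<times> nat \<Rightarrow> int) \<Rightarrow> int" where
  "aug eps f = (\<Sum>c\<in>{c. f c \<noteq> 0}. f c * eps (snd c))"

text \<open>k n is the rank of the n-th free module, d n j (n \<ge> 1) is the boundary of the
j-th basis element of degree n; the sequence ... \<rightarrow> F_1 \<rightarrow> F_0 \<rightarrow> Z \<rightarrow> 0 is exact.\<close>
definition free_resolution_fin_type ::
  "'g monoid \<Rightarrow> (nat \<Rightarrow> nat) \<Rightarrow> (nat \<Rightarrow> nat \<Rightarrow> ('g \<times> nat \<Rightarrow> int)) \<Rightarrow> (nat \<Rightarrow> int) \<Rightarrow> bool" where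
  "free_resolution_fin_type G k d eps \<longleftrightarrow>
     (\<forall>n\<ge>1. \<forall>j<k n. d n j \<in> chains G (k (n - 1))) \<and>
     (\<exists>f\<in>chains G (k 0). aug eps f = 1) \<and>
     (\<forall>f\<in>chains G (k 0). aug eps f = 0 \<longleftrightarrow> (\<exists>c\<in>chains G (k 1). bdry G (d 1) c = f)) \<and>
     (\<forall>n\<ge>1. \<forall>f\<in>chains G (k n).
        bdry G (d n) f = (\<lambda>_. 0) \<longleftrightarrow> (\<exists>c\<in>chains G (k (Suc n)). bdry G (d (Suc n)) c = f))"

text \<open>An n-cochain is an integer function on the n-cells (g,j), g in G, j < k n.\<close>
definition bounded_cochain :: "'g monoid \<Rightarrow> (nat \<Rightarrow> nat) \<Rightarrow> nat \<Rightarrow> ('g \<times> nat \<Rightarrow> int) \<Rightarrow> bool" where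
  "bounded_cochain G k n \<phi> \<longleftrightarrow> (\<exists>b. \<forall>g\<in>carrier G. \<forall>j<k n. \<bar>\<phi> (g, j)\<bar> \<le> b)"

text \<open>Coboundary of an n-cochain, evaluated at the (n+1)-cell g e_j:
phi(d(g e_j)).\<close>
definition coboundary :: "'g monoid \<Rightarrow> (nat \<Rightarrow> nat \<Rightarrow> ('g \<times> nat \<Rightarrow> int)) \<Rightarrow> nat \<Rightarrow> ('g \<times> nat \<Rightarrow> int) \<Rightarrow> ('g \<times> nat \<Rightarrow> int)" where
  "coboundary G d n \<phi> = (\<lambda>(g, j). \<Sum>c\<in>{c. d (Suc n) j c \<noteq> 0}. d (Suc n) j c * \<phi> (g \<otimes>\<^bsub>G\<^esub> fst c, snd c))"

definition linf_cohomology_vanishes ::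
  "'g monoid \<Rightarrow> (nat \<Rightarrow> nat) \<Rightarrow> (nat \<Rightarrow> nat \<Rightarrow> ('g \<times> nat \<Rightarrow> int)) \<Rightarrow> nat \<Rightarrow> bool" where
  "linf_cohomology_vanishes G k d n \<longleftrightarrow>
     (\<forall>\<phi>. bounded_cochain G k n \<phi> \<and>
           (\<forall>g\<in>carrier G. \<forall>j<k (Suc n). coboundary G d n \<phi> (g, j) = 0) \<longrightarrow>
        (\<exists>\<psi>. bounded_cochain G k (n - 1) \<psi> \<and>
             (\<forall>g\<in>carrier G. \<forall>j<k n. coboundary G d (n - 1) \<psi> (g, j) = \<phi> (g, j))))"

end

theory Submission
  imports Defs "HOL-Library.Poly_Mapping"
begin

text \<open>
  A bounded cocycle on the resolution is pulled back to an integral cocycle \<open>F\<close> on the homogeneous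
  bar complex which is normalized and bounded on simplices of bounded diameter. It is enough to find
  a primitive with the same bound: a primitive on the bar complex is transported back along a chain
  map of resolutions, and the error is corrected by an equivariant chain homotopy, which is bounded
  because the modules are finitely generated.

  On the bar complex a real primitive is built on balls of growing radius around \<open>1\<close>: project a
  simplex to the previous ball by choosing, independently and uniformly for each vertex, a point
  near a geodesic to \<open>1\<close>, and average the value of the primitive on the projection, corrected by
  \<open>F\<close> on the prism. Hyperbolicity makes the projections of small simplices small, and two vertices
  are projected to the same point with probability bounded below. Since the primitive vanishes on
  degenerate simplices and has degree at least \<open>1\<close>, averaging is a contraction up to a bounded term,
  so the primitive stays bounded. Rounding its values on the cone from \<open>1\<close> makes it integral.
\<close>

section \<open>Cochains on tuples\<close>

definition alternating_sum :: "'b::ab_group_add list \<Rightarrow> 'b" where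
  "alternating_sum bs = foldr (-) bs 0"

lemma alternating_sum_simps [simp]:
  "alternating_sum [] = 0"
  "alternating_sum (b # bs) = b - alternating_sum bs"
  by (simp_all add: alternating_sum_def)

lemma alternating_sum_map_zero [simp]: "alternating_sum (map (\<lambda>_. 0) xs) = 0"
  by (induction xs) auto

lemma alternating_sum_map_add:
  "alternating_sum (map (\<lambda>x. f x + g x) xs) =
    alternating_sum (map f xs) + alternating_sum (map g xs)"
  by (induction xs) auto

lemma alternating_sum_map_diff:
  "alternating_sum (map (\<lambda>x. f x - g x) xs) =
    alternating_sum (map f xs) - alternating_sum (map g xs)"
  by (induction xs) auto

lemma alternating_sum_map_additive:
  assumes "additive h"
  shows "alternating_sum (map (\<lambda>x. h (f x)) xs) = h (alternating_sum (map f xs))"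
  by (induction xs) (simp_all add: additive.zero[OF assms] additive.diff[OF assms])

lemma abs_alternating_sum_le:
  fixes bs :: "'b::linordered_idom list"
  assumes "\<And>b. b \<in> set bs \<Longrightarrow> \<bar>b\<bar> \<le> B"
  shows "\<bar>alternating_sum bs\<bar> \<le> of_nat (length bs) * B"
  using assms
proof (induction bs)
  case (Cons b bs)
  have "\<bar>b - alternating_sum bs\<bar> \<le> \<bar>b\<bar> + \<bar>alternating_sum bs\<bar>"
    by (rule abs_triangle_ineq4)
  also have "\<dots> \<le> B + of_nat (length bs) * B"
    using Cons by (intro add_mono) auto
  finally show ?case by (simp add: algebra_simps)
qed auto

definition tuples :: "'a set \<Rightarrow> nat \<Rightarrow> 'a list set" where
  "tuples X n = {xs. set xs \<subseteq> X \<and> length xs = n}"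

lemma tuples_iff: "xs \<in> tuples X n \<longleftrightarrow> set xs \<subseteq> X \<and> length xs = n"
  by (simp add: tuples_def)

lemma tuples_mono: "X \<subseteq> Y \<Longrightarrow> tuples X n \<subseteq> tuples Y n"
  by (force simp: tuples_iff)

lemma Cons_tuples_iff [simp]: "x # xs \<in> tuples X (Suc n) \<longleftrightarrow> x \<in> X \<and> xs \<in> tuples X n"
  by (auto simp: tuples_iff)

lemma map_in_tuples: "xs \<in> tuples X n \<Longrightarrow> (\<And>x. x \<in> X \<Longrightarrow> f x \<in> Y) \<Longrightarrow> map f xs \<in> tuples Y n"
  by (auto simp: tuples_iff)

lemma tuples_SucE:
  assumes "xs \<in> tuples X (Suc n)"
  obtains y ys where "xs = y # ys" "y \<in> X" "ys \<in> tuples X n"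
  using assms by (cases xs) (auto simp: tuples_iff)

lemma finite_tuples: "finite X \<Longrightarrow> finite (tuples X n)"
  unfolding tuples_def by (rule finite_lists_length_eq)

fun faces :: "'a list \<Rightarrow> 'a list list" where
  "faces [] = []"
| "faces (x # xs) = xs # map ((#) x) (faces xs)"

lemma faces_in_tuples: "xs \<in> tuples X (Suc n) \<Longrightarrow> ys \<in> set (faces xs) \<Longrightarrow> ys \<in> tuples X n"
proof (induction xs arbitrary: n ys)
  case (Cons x xs)
  then have xs: "x \<in> X" "xs \<in> tuples X n" by simp_all
  show ?case
  proof (cases "ys = xs")
    case False
    with Cons.prems(2) obtain zs where zs: "ys = x # zs" "zs \<in> set (faces xs)" by auto
    then have "xs \<noteq> []" by auto
    with xs(2) obtain m where "n = Suc m" by (cases n) (auto simp: tuples_iff)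
    with xs zs Cons.IH show ?thesis by simp
  qed (simp add: xs)
qed simp

lemma length_faces: "length (faces xs) = length xs"
  by (induction xs) auto

text \<open>Tuples of length \<open>n + 1\<close> are the \<open>n\<close>-simplices; the complex is augmented by the empty tuple.\<close>

definition cobd :: "('a list \<Rightarrow> 'b::ab_group_add) \<Rightarrow> 'a list \<Rightarrow> 'b" where
  "cobd P xs = alternating_sum (map P (faces xs))"

lemma cobd_simps [simp]:
  "cobd P [] = 0"
  "cobd P (x # xs) = P xs - cobd (\<lambda>ys. P (x # ys)) xs"
  by (simp_all add: cobd_def o_def)

lemma cobd_zero [simp]: "cobd (\<lambda>_. 0) xs = 0"
  by (simp add: cobd_def)

lemma cobd_add: "cobd (\<lambda>ys. P ys + Q ys) xs = cobd P xs + cobd Q xs"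
  by (simp add: cobd_def alternating_sum_map_add)

lemma cobd_diff: "cobd (\<lambda>ys. P ys - Q ys) xs = cobd P xs - cobd Q xs"
  by (simp add: cobd_def alternating_sum_map_diff)

lemma cobd_additive: "additive h \<Longrightarrow> cobd (\<lambda>ys. h (P ys)) xs = h (cobd P xs)"
  by (simp add: cobd_def alternating_sum_map_additive)

lemma cobd_of_int: "cobd (\<lambda>ys. of_int (P ys)) xs = of_int (cobd P xs)"
  by (rule cobd_additive) (simp add: additive_def)

lemma cobd_cong: "(\<And>ys. ys \<in> set (faces xs) \<Longrightarrow> P ys = Q ys) \<Longrightarrow> cobd P xs = cobd Q xs"
  unfolding cobd_def by (intro arg_cong[where f = alternating_sum] map_cong) auto

lemma abs_cobd_le:
  fixes P :: "'a list \<Rightarrow> 'b::linordered_idom"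
  assumes "\<And>ys. ys \<in> set (faces xs) \<Longrightarrow> \<bar>P ys\<bar> \<le> B"
  shows "\<bar>cobd P xs\<bar> \<le> of_nat (length xs) * B"
  using assms abs_alternating_sum_le[of "map P (faces xs)" B] by (auto simp: cobd_def length_faces)

lemma cobd_map: "cobd (\<lambda>ys. P (map Y ys)) xs = cobd P (map Y xs)"
proof (induction xs arbitrary: P)
  case (Cons x xs)
  then show ?case using Cons.IH[of "\<lambda>ys. P (Y x # ys)"] by simp
qed simp

lemma cobd_cobd: "cobd (cobd P) xs = 0"
  by (induction xs arbitrary: P) (auto simp: cobd_diff)

definition normalized :: "('a list \<Rightarrow> 'b::zero) \<Rightarrow> bool" where
  "normalized P \<longleftrightarrow> (\<forall>xs. \<not> distinct_adj xs \<longrightarrow> P xs = 0)"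

lemma normalizedD: "normalized P \<Longrightarrow> \<not> distinct_adj xs \<Longrightarrow> P xs = 0"
  by (simp add: normalized_def)

lemma normalized_Cons: "normalized P \<Longrightarrow> normalized (\<lambda>ys. P (x # ys))"
  unfolding normalized_def by (metis distinct_adj_ConsD)

lemma normalized_cobd:
  assumes "normalized P"
  shows "normalized (cobd P)"
  unfolding normalized_def
proof (intro allI impI)
  fix xs :: "'a list"
  assume "\<not> distinct_adj xs"
  with assms show "cobd P xs = 0"
  proof (induction xs arbitrary: P)
    case (Cons x xs)
    show ?case
    proof (cases "distinct_adj xs")
      case False
      with Cons show ?thesis by (simp add: normalizedD normalized_Cons)
    next
      case True
      with Cons.prems(2) obtain ys where "xs = x # ys"
        by (cases xs) (auto simp: distinct_adj_Cons)
      with Cons.prems(1) show ?thesis by (simp add: normalizedD)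
    qed
  qed simp
qed

text \<open>The prism over \<open>x\<^sub>0, \<dots>, x\<^sub>n\<close> consists of the simplices \<open>x\<^sub>0, \<dots>, x\<^sub>i, Y x\<^sub>i, \<dots>, Y x\<^sub>n\<close>.\<close>

fun prism_simplices :: "('a \<Rightarrow> 'a) \<Rightarrow> 'a list \<Rightarrow> 'a list list" where
  "prism_simplices Y [] = []"
| "prism_simplices Y (x # xs) = (x # Y x # map Y xs) # map ((#) x) (prism_simplices Y xs)"

lemma length_prism_simplices: "length (prism_simplices Y xs) = length xs"
  by (induction xs) auto

lemma prism_simplices_in_tuples:
  "ys \<in> set (prism_simplices Y xs) \<Longrightarrow> ys \<in> tuples (set xs \<union> Y ` set xs) (Suc (length xs))"
proof (induction xs arbitrary: ys)
  case (Cons x xs)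
  show ?case
  proof (cases "ys = x # Y x # map Y xs")
    case True
    then show ?thesis by (auto simp: tuples_iff)
  next
    case False
    with Cons.prems obtain zs where "ys = x # zs" "zs \<in> set (prism_simplices Y xs)" by auto
    then show ?thesis
      using Cons.IH tuples_mono[of "set xs \<union> Y ` set xs" "set (x # xs) \<union> Y ` set (x # xs)"] by auto
  qed
qed simp

definition prism :: "('a \<Rightarrow> 'a) \<Rightarrow> ('a list \<Rightarrow> 'b::ab_group_add) \<Rightarrow> 'a list \<Rightarrow> 'b" where
  "prism Y P xs = alternating_sum (map P (prism_simplices Y xs))"

lemma prism_simps [simp]:
  "prism Y P [] = 0"
  "prism Y P (x # xs) = P (x # Y x # map Y xs) - prism Y (\<lambda>ys. P (x # ys)) xs"
  by (simp_all add: prism_def o_def)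

lemma prism_zero [simp]: "prism Y (\<lambda>_. 0) xs = 0"
  by (simp add: prism_def)

lemma prism_diff: "prism Y (\<lambda>ys. P ys - Q ys) xs = prism Y P xs - prism Y Q xs"
  by (simp add: prism_def alternating_sum_map_diff)

lemma prism_eq_0: "(\<And>ys. ys \<in> set (prism_simplices Y xs) \<Longrightarrow> P ys = 0) \<Longrightarrow> prism Y P xs = 0"
  unfolding prism_def by (metis alternating_sum_map_zero map_cong)

lemma abs_prism_le:
  fixes P :: "'a list \<Rightarrow> 'b::linordered_idom"
  assumes "\<And>ys. ys \<in> set (prism_simplices Y xs) \<Longrightarrow> \<bar>P ys\<bar> \<le> B"
  shows "\<bar>prism Y P xs\<bar> \<le> of_nat (length xs) * B"
  using assms abs_alternating_sum_le[of "map P (prism_simplices Y xs)" B]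
  by (auto simp: prism_def length_prism_simplices)

lemma prism_homotopy: "cobd (prism Y P) xs + prism Y (cobd P) xs = P (map Y xs) - P xs"
proof (induction xs arbitrary: P)
  case (Cons x xs)
  show ?case
    using Cons.IH[of "\<lambda>ys. P (x # ys)"] cobd_map[of "\<lambda>ys. P (x # Y x # ys)" Y xs]
    by (simp add: cobd_diff prism_diff algebra_simps)
qed simp

lemma prism_fixed:
  assumes "normalized P" "\<And>x. x \<in> set xs \<Longrightarrow> Y x = x"
  shows "prism Y P xs = 0"
  using assms
proof (induction xs arbitrary: P)
  case (Cons x xs)
  then show ?case
    using Cons.IH[OF normalized_Cons[OF Cons.prems(1)]] by (simp add: normalizedD)
qed simp

lemma prism_degenerate: "normalized P \<Longrightarrow> prism Y P (x # x # xs) = 0"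
  by (simp add: normalizedD)

section \<open>Averages\<close>

definition avg :: "('a \<Rightarrow> real) \<Rightarrow> 'a set \<Rightarrow> real" where
  "avg f A = sum f A / card A"

lemma avg_zero [simp]: "avg (\<lambda>_. 0) A = 0"
  by (simp add: avg_def)

lemma avg_diff: "avg (\<lambda>x. f x - g x) A = avg f A - avg g A"
  by (simp add: avg_def sum_subtractf diff_divide_distrib)

lemma avg_cong: "(\<And>x. x \<in> A \<Longrightarrow> f x = g x) \<Longrightarrow> avg f A = avg g A"
  by (simp add: avg_def)

lemma avg_const: "finite A \<Longrightarrow> A \<noteq> {} \<Longrightarrow> avg (\<lambda>_. c) A = c"
  by (simp add: avg_def)

lemma cobd_avg: "cobd (\<lambda>ys. avg (\<lambda>Y. P Y ys) A) xs = avg (\<lambda>Y. cobd (P Y) xs) A"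
  by (induction xs arbitrary: P) (simp_all add: avg_diff)

lemma abs_avg_le:
  assumes "finite A" "\<And>x. x \<in> A \<Longrightarrow> \<bar>f x\<bar> \<le> M" "M \<ge> 0"
  shows "\<bar>avg f A\<bar> \<le> M"
proof -
  have "\<bar>sum f A\<bar> \<le> (\<Sum>x\<in>A. M)"
    using assms(2) by (intro order_trans[OF sum_abs] sum_mono)
  then show ?thesis
    using assms by (cases "card A = 0") (simp_all add: avg_def divide_le_eq mult.commute)
qed

lemma abs_avg_le_of_vanishing:
  assumes "finite A" "\<And>x. x \<in> A \<Longrightarrow> \<bar>f x\<bar> \<le> M"
    and "card A \<le> card {x \<in> A. f x = 0} * N" "N > 0" "M \<ge> 0"
  shows "\<bar>avg f A\<bar> \<le> M - M / N"
proof (cases "A = {}")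
  case True
  have "M / N \<le> M / 1"
    using assms(4,5) by (intro divide_left_mono) auto
  then show ?thesis using True by (simp add: avg_def)
next
  case False
  define Z where "Z = {x \<in> A. f x = 0}"
  have Z: "Z \<subseteq> A" "finite Z" using assms(1) by (auto simp: Z_def)
  have pos: "card A > 0" using False assms(1) by (simp add: card_gt_0_iff)
  have "\<bar>sum f A\<bar> = \<bar>sum f (A - Z)\<bar>"
    using assms(1) by (intro arg_cong[where f = abs] sum.mono_neutral_right) (auto simp: Z_def)
  also have "\<dots> \<le> (\<Sum>x\<in>A - Z. M)"
    using assms(2) by (intro order_trans[OF sum_abs] sum_mono) auto
  also have "\<dots> = (card A - real (card Z)) * M"
    using Z assms(1) by (simp add: card_Diff_subset of_nat_diff card_mono)
  also have "\<dots> \<le> (card A - card A / N) * M"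
  proof (intro mult_right_mono diff_left_mono)
    have "real (card A) \<le> real (card Z * N)"
      using assms(3) by (simp only: of_nat_le_iff Z_def)
    then show "card A / N \<le> real (card Z)"
      using assms(4) by (simp add: divide_le_eq)
  qed fact
  finally show ?thesis
    using pos assms(4) by (simp add: avg_def field_simps)
qed

section \<open>Controlled cochains on a metric space\<close>

locale nat_metric =
  fixes X :: "'a set" and d :: "'a \<Rightarrow> 'a \<Rightarrow> nat"
  assumes dist_eq_0_iff: "x \<in> X \<Longrightarrow> y \<in> X \<Longrightarrow> d x y = 0 \<longleftrightarrow> x = y"
    and dist_sym: "x \<in> X \<Longrightarrow> y \<in> X \<Longrightarrow> d x y = d y x"
    and dist_triangle: "x \<in> X \<Longrightarrow> y \<in> X \<Longrightarrow> z \<in> X \<Longrightarrow> d x z \<le> d x y + d y z"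
begin

definition diam_le :: "nat \<Rightarrow> 'a list \<Rightarrow> bool" where
  "diam_le D xs \<longleftrightarrow> (\<forall>x\<in>set xs. \<forall>y\<in>set xs. d x y \<le> D)"

lemma diam_leD: "diam_le D xs \<Longrightarrow> x \<in> set xs \<Longrightarrow> y \<in> set xs \<Longrightarrow> d x y \<le> D"
  by (simp add: diam_le_def)

lemma diam_le_mono: "diam_le D xs \<Longrightarrow> D \<le> E \<Longrightarrow> diam_le E xs"
  unfolding diam_le_def by (meson le_trans)

lemma diam_le_nearby:
  assumes "diam_le D xs" "set xs \<subseteq> X" "set ys \<subseteq> X"
    and near: "\<And>y. y \<in> set ys \<Longrightarrow> \<exists>x\<in>set xs. d x y \<le> r"
  shows "diam_le (D + 2 * r) ys"
  unfolding diam_le_def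
proof (intro ballI)
  fix y z assume yz: "y \<in> set ys" "z \<in> set ys"
  then obtain a b where ab: "a \<in> set xs" "d a y \<le> r" "b \<in> set xs" "d b z \<le> r"
    using near by meson
  then have "a \<in> X" "b \<in> X" "y \<in> X" "z \<in> X" using assms(2,3) yz by auto
  then have "d y z \<le> d a y + (d a b + d b z)"
    using dist_triangle[of y a z] dist_triangle[of a b z] dist_sym[of y a] by simp
  also have "\<dots> \<le> D + 2 * r" using ab diam_leD[OF assms(1), of a b] by simp
  finally show "d y z \<le> D + 2 * r" .
qed

lemma ex_diam_le: "\<exists>D. diam_le D xs"
proof -
  let ?S = "(\<lambda>(x, y). d x y) ` (set xs \<times> set xs)"
  have "diam_le (Max ?S) xs"
    unfolding diam_le_def by (intro ballI Max_ge) auto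
  then show ?thesis ..
qed

definition controlled :: "nat \<Rightarrow> ('a list \<Rightarrow> 'b::linordered_idom) \<Rightarrow> bool" where
  "controlled n P \<longleftrightarrow> (\<forall>D. \<exists>B. \<forall>xs\<in>tuples X n. diam_le D xs \<longrightarrow> \<bar>P xs\<bar> \<le> B)"

lemma controlledE:
  assumes "controlled n P"
  obtains B where "B \<ge> 0" "\<And>xs. xs \<in> tuples X n \<Longrightarrow> diam_le D xs \<Longrightarrow> \<bar>P xs\<bar> \<le> B"
proof -
  obtain B where "\<And>xs. xs \<in> tuples X n \<Longrightarrow> diam_le D xs \<Longrightarrow> \<bar>P xs\<bar> \<le> B"
    using assms unfolding controlled_def by blast
  then show ?thesis by (intro that[of "max 0 B"]) (auto intro: max.coboundedI2)
qed

end

section \<open>Random projections in a hyperbolic space\<close>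

text \<open>Assumption \<open>hyperbolic\<close> is Gromov's four-point inequality with constant \<open>\<delta> / 2\<close> at the base
  point, rearranged so that no subtraction of natural numbers occurs.\<close>

locale hyperbolic_space = nat_metric X d
  for X :: "'a set" and d :: "'a \<Rightarrow> 'a \<Rightarrow> nat" +
  fixes base :: 'a and \<delta> :: nat
  assumes base_in: "base \<in> X"
    and hyperbolic: "x \<in> X \<Longrightarrow> y \<in> X \<Longrightarrow> z \<in> X \<Longrightarrow>
      d x z + d base y \<le> max (d x y + d base z) (d y z + d base x) + \<delta>"
    and geodesic_to_base:
      "x \<in> X \<Longrightarrow> m \<le> d base x \<Longrightarrow> \<exists>y\<in>X. d base y = m \<and> d x y = d base x - m"
    and bounded_geometry:
      "\<exists>N. \<forall>x\<in>X. finite {y \<in> X. d x y \<le> r} \<and> card {y \<in> X. d x y \<le> r} \<le> N"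
begin

text \<open>Wide enough that projections decrease all distances above \<open>3 * \<delta>\<close> on a sphere.\<close>

definition width :: nat where "width = 2 * \<delta> + 1"

definition disc :: "nat \<Rightarrow> 'a set" where "disc J = {x \<in> X. d base x \<le> width * J}"

text \<open>Outside the disc: the points of its boundary near a geodesic from \<open>x\<close> to the base point.\<close>

definition shadow :: "nat \<Rightarrow> 'a \<Rightarrow> 'a set" where
  "shadow J x = (if d base x \<le> width * J then {x}
     else {y \<in> X. d base y = width * J \<and> d x y + width * J \<le> d base x + \<delta>})"

definition projections :: "nat \<Rightarrow> ('a \<Rightarrow> 'a) set" where
  "projections J = PiE (disc (Suc J)) (shadow J)"

lemma disc_subset: "disc J \<subseteq> X"
  by (auto simp: disc_def)

lemma disc_mono: "I \<le> J \<Longrightarrow> disc I \<subseteq> disc J"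
  unfolding disc_def by (auto intro: order_trans mult_le_mono2)

lemma finite_disc: "finite (disc J)"
  using bounded_geometry[of "width * J"] base_in by (auto simp: disc_def)

lemma disc_0: "disc 0 = {base}"
  using dist_eq_0_iff base_in by (auto simp: disc_def)

lemma tuple_in_disc:
  assumes "xs \<in> tuples X n"
  shows "\<exists>J. xs \<in> tuples (disc J) n"
proof -
  have "x \<in> disc (sum_list (map (d base) xs))" if "x \<in> set xs" for x
  proof -
    have "d base x \<le> sum_list (map (d base) xs)"
      using that by (intro member_le_sum_list) auto
    also have "\<dots> \<le> width * sum_list (map (d base) xs)" by (simp add: width_def)
    finally show ?thesis using that assms by (auto simp: disc_def tuples_iff)
  qed
  then show ?thesis using assms by (auto simp: tuples_iff)
qed

lemma shadow_nonempty: "x \<in> X \<Longrightarrow> shadow J x \<noteq> {}"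
  using geodesic_to_base[of x "width * J"] by (auto simp: shadow_def; force)

lemma shadow_in_disc: "x \<in> X \<Longrightarrow> shadow J x \<subseteq> disc J"
  by (auto simp: shadow_def disc_def)

lemma shadow_dist:
  assumes "x \<in> disc (Suc J)" "y \<in> shadow J x"
  shows "d x y \<le> width + \<delta>"
  using assms dist_eq_0_iff[of x x] by (auto simp: shadow_def disc_def split: if_splits)

lemma shadow_radius: "x \<in> X \<Longrightarrow> y \<in> shadow J x \<Longrightarrow> d base y = min (d base x) (width * J)"
  by (auto simp: shadow_def split: if_splits)

lemma finite_shadow: "x \<in> X \<Longrightarrow> finite (shadow J x)"
  using finite_subset[OF shadow_in_disc finite_disc] .

lemma card_shadow_bounded: "\<exists>N>0. \<forall>J. \<forall>x\<in>disc (Suc J). card (shadow J x) \<le> N"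
proof -
  obtain N where N: "\<And>x. x \<in> X \<Longrightarrow> finite {y \<in> X. d x y \<le> width + \<delta>}"
      "\<And>x. x \<in> X \<Longrightarrow> card {y \<in> X. d x y \<le> width + \<delta>} \<le> N"
    using bounded_geometry by blast
  have "card (shadow J x) \<le> Suc N" if "x \<in> disc (Suc J)" for J x
  proof -
    have x: "x \<in> X" using that disc_subset by blast
    have "shadow J x \<subseteq> {y \<in> X. d x y \<le> width + \<delta>}"
      using shadow_dist[OF that] shadow_in_disc[OF x] disc_subset by blast
    then show ?thesis using N[OF x] card_mono le_trans le_SucI by meson
  qed
  then show ?thesis by blast
qed

lemma finite_projections: "finite (projections J)"
  unfolding projections_def using finite_disc finite_shadow disc_subset by (intro finite_PiE) blast+

lemma projections_nonempty: "projections J \<noteq> {}"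
  unfolding projections_def using shadow_nonempty disc_subset by (auto simp: PiE_eq_empty_iff)

lemma projection_in_shadow: "Y \<in> projections J \<Longrightarrow> x \<in> disc (Suc J) \<Longrightarrow> Y x \<in> shadow J x"
  by (auto simp: projections_def)

lemma projection_in_disc: "Y \<in> projections J \<Longrightarrow> x \<in> disc (Suc J) \<Longrightarrow> Y x \<in> disc J"
  using projection_in_shadow shadow_in_disc disc_subset by blast

lemma projection_fixed: "Y \<in> projections J \<Longrightarrow> x \<in> disc J \<Longrightarrow> Y x = x"
  using projection_in_shadow[of Y J x] disc_mono[of J "Suc J"] by (auto simp: shadow_def disc_def)

lemma projection_dist: "Y \<in> projections J \<Longrightarrow> x \<in> disc (Suc J) \<Longrightarrow> d x (Y x) \<le> width + \<delta>"
  using projection_in_shadow shadow_dist by blast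

lemma projection_diam_le:
  assumes "Y \<in> projections J" "xs \<in> tuples (disc (Suc J)) n" "diam_le D xs"
    and "ys \<in> tuples (set xs \<union> Y ` set xs) m"
  shows "ys \<in> tuples X m" "diam_le (D + 2 * (width + \<delta>)) ys"
proof -
  have xs: "set xs \<subseteq> disc (Suc J)" using assms(2) by (simp add: tuples_iff)
  then have "set xs \<subseteq> X" using disc_subset by blast
  moreover have "Y ` set xs \<subseteq> X"
    using projection_in_disc[OF assms(1)] xs disc_subset by blast
  ultimately show "ys \<in> tuples X m"
    using assms(4) tuples_mono[of "set xs \<union> Y ` set xs" X] by blast
  then have ys: "set ys \<subseteq> X" by (simp add: tuples_iff)
  have "\<exists>x\<in>set xs. d x y \<le> width + \<delta>" if "y \<in> set ys" for y
  proof (cases "y \<in> set xs")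
    case True
    with that ys have "d y y = 0" using dist_eq_0_iff by blast
    with True show ?thesis by (intro bexI[of _ y]) simp_all
  next
    case False
    with that assms(4) obtain x where "x \<in> set xs" "y = Y x"
      by (force simp: tuples_iff)
    with xs projection_dist[OF assms(1)] show ?thesis by blast
  qed
  with assms(3) \<open>set xs \<subseteq> X\<close> ys show "diam_le (D + 2 * (width + \<delta>)) ys"
    by (rule diam_le_nearby)
qed

lemma sphere_shadow:
  assumes "x \<in> X" "d base x = width * Suc J" "y \<in> shadow J x"
  shows "y \<in> X" "d base y = width * J" "d x y \<le> width + \<delta>"
proof -
  have "\<not> d base x \<le> width * J" using assms(2) by (simp add: width_def)
  with assms show "y \<in> X" "d base y = width * J" "d x y \<le> width + \<delta>"
    by (auto simp: shadow_def)
qed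

lemma shadow_contracts:
  assumes "x \<in> X" "x' \<in> X" "d base x = width * Suc J" "d base x' = width * Suc J"
    and "y \<in> shadow J x" "y' \<in> shadow J x'"
  shows "d y y' \<le> max (3 * \<delta>) (d x x' + 2 * \<delta> - 2 * width)"
proof -
  note y = sphere_shadow[OF assms(1,3,5)] and y' = sphere_shadow[OF assms(2,4,6)]
  have "d x y' + d base x' \<le> max (d x x' + d base y') (d x' y' + d base x) + \<delta>"
    using hyperbolic assms(2) assms(1) y'(1) by blast
  moreover have "d y y' + d base x \<le> max (d y x + d base y') (d x y' + d base y) + \<delta>"
    using hyperbolic y(1) assms(1) y'(1) by blast
  moreover have "d y x = d x y" using dist_sym assms(1) y(1) by blast
  moreover have "width * Suc J = width * J + width" by simp
  ultimately show ?thesis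
    using y(2,3) y'(2,3) assms(3,4) width_def by linarith
qed

lemma shadows_meet:
  assumes "x \<in> X" "x' \<in> X" "d base x = width * Suc J" "d base x' = width * Suc J" "d x x' \<le> 3 * \<delta>"
  obtains y where "y \<in> shadow J x" "y \<in> shadow J x'"
proof -
  have radius: "width * Suc J = width * J + width" by simp
  obtain y where y: "y \<in> X" "d base y = width * J" "d x y = width"
    using geodesic_to_base[of x "width * J"] assms(1,3) by auto
  have "d x' y + d base x \<le> max (d x' x + d base y) (d x y + d base x') + \<delta>"
    using hyperbolic assms(1,2) y(1) by blast
  moreover have "d x' x = d x x'" using dist_sym assms(1,2) by blast
  ultimately have "d x' y \<le> width + \<delta>"
    using y assms(3-5) width_def radius by linarith
  moreover have "\<not> width * Suc J \<le> width * J" by (simp add: width_def)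
  ultimately show ?thesis
    using that[of y] y assms(3,4) radius by (auto simp: shadow_def)
qed

text \<open>Resetting the values at \<open>x\<close> and \<open>x'\<close> to a common point loses at most two coordinates.\<close>

lemma card_projections_le_coinciding:
  assumes "x \<in> disc (Suc J)" "x' \<in> disc (Suc J)" "y \<in> shadow J x" "y \<in> shadow J x'"
    and N: "card (shadow J x) \<le> N" "card (shadow J x') \<le> N"
  shows "card (projections J) \<le> card {Y \<in> projections J. Y x = Y x'} * (N * N)"
proof -
  let ?C = "{Y \<in> projections J. Y x = Y x'}"
  let ?reset = "\<lambda>Y. (Y(x := y, x' := y), Y x, Y x')"
  have "inj_on ?reset (projections J)"
    by (rule inj_onI)
      (metis (no_types, lifting) fun_upd_idem_iff fun_upd_twist fun_upd_upd prod.inject)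
  moreover have "?reset ` projections J \<subseteq> ?C \<times> (shadow J x \<times> shadow J x')"
    using assms by (auto simp: projections_def PiE_iff extensional_def)
  moreover have "finite (shadow J x)" "finite (shadow J x')"
    using assms(1,2) disc_subset finite_shadow by blast+
  then have "finite (?C \<times> (shadow J x \<times> shadow J x'))"
    using finite_projections by auto
  ultimately have "card (projections J) \<le> card (?C \<times> (shadow J x \<times> shadow J x'))"
    using card_inj_on_le by blast
  also have "\<dots> = card ?C * (card (shadow J x) * card (shadow J x'))"
    by (simp add: card_cartesian_product)
  also have "\<dots> \<le> card ?C * (N * N)"
    using N by (intro mult_le_mono) auto
  finally show ?thesis .
qed

end

section \<open>Bounded primitives\<close>

locale controlled_cocycle = hyperbolic_space X d base \<delta>
  for X :: "'a set" and d :: "'a \<Rightarrow> 'a \<Rightarrow> nat" and base :: 'a and \<delta> :: nat +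
  fixes n :: nat and \<Phi> :: "'a list \<Rightarrow> real"
  assumes degree: "n \<ge> 2"
    and normalized_\<Phi>: "normalized \<Phi>"
    and cocycle: "xs \<in> tuples X (Suc (Suc n)) \<Longrightarrow> cobd \<Phi> xs = 0"
    and controlled_\<Phi>: "controlled (Suc n) \<Phi>"
begin

primrec disc_primitive :: "nat \<Rightarrow> 'a list \<Rightarrow> real" where
  "disc_primitive 0 = (\<lambda>_. 0)"
| "disc_primitive (Suc J) =
    (\<lambda>xs. avg (\<lambda>Y. disc_primitive J (map Y xs) - prism Y \<Phi> xs) (projections J))"

lemma tuple_Cons_ConsE:
  assumes "xs \<in> tuples A m" "m \<ge> n"
  obtains x x' zs where "xs = x # x' # zs" "x \<in> A" "x' \<in> A"
  using assms degree by (cases xs; cases "tl xs") (auto simp: tuples_iff)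

lemma cobd_pullback_minus_prism:
  assumes Y: "Y \<in> projections J" and xs: "xs \<in> tuples (disc (Suc J)) (Suc n)"
    and P: "cobd P (map Y xs) = \<Phi> (map Y xs)"
  shows "cobd (\<lambda>ys. P (map Y ys) - prism Y \<Phi> ys) xs = \<Phi> xs"
proof -
  have length: "length xs = Suc n" using xs by (simp add: tuples_iff)
  have "set xs \<union> Y ` set xs \<subseteq> X"
    using xs projection_in_disc[OF Y] disc_subset by (force simp: tuples_iff)
  then have "tuples (set xs \<union> Y ` set xs) (Suc (length xs)) \<subseteq> tuples X (Suc (Suc n))"
    unfolding length by (rule tuples_mono)
  then have "prism Y (cobd \<Phi>) xs = 0"
    by (intro prism_eq_0 cocycle) (auto dest: prism_simplices_in_tuples)
  then show ?thesis
    using prism_homotopy[of Y \<Phi> xs] P by (simp add: cobd_diff cobd_map)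
qed

lemma cobd_disc_primitive: "xs \<in> tuples (disc J) (Suc n) \<Longrightarrow> cobd (disc_primitive J) xs = \<Phi> xs"
proof (induction J arbitrary: xs)
  case 0
  then obtain zs where "xs = base # base # zs"
    by (rule tuple_Cons_ConsE) (auto simp: disc_0)
  then show ?case using normalized_\<Phi> by (simp add: normalizedD)
next
  case (Suc J)
  have "cobd (\<lambda>ys. disc_primitive J (map Y ys) - prism Y \<Phi> ys) xs = \<Phi> xs"
    if "Y \<in> projections J" for Y
    using that Suc.prems
    by (intro cobd_pullback_minus_prism Suc.IH) (auto intro: map_in_tuples projection_in_disc)
  then have "cobd (disc_primitive (Suc J)) xs = avg (\<lambda>_. \<Phi> xs) (projections J)"
    by (auto simp: cobd_avg intro: avg_cong)
  then show ?case by (simp add: avg_const finite_projections projections_nonempty)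
qed

lemma disc_primitive_Suc_eq:
  assumes "xs \<in> tuples (disc J) m"
  shows "disc_primitive (Suc J) xs = disc_primitive J xs"
proof -
  have "disc_primitive J (map Y xs) - prism Y \<Phi> xs = disc_primitive J xs"
    if "Y \<in> projections J" for Y
  proof -
    have fixed: "Y x = x" if "x \<in> set xs" for x
      using that assms projection_fixed[OF \<open>Y \<in> projections J\<close>] by (auto simp: tuples_iff)
    then have "prism Y \<Phi> xs = 0" by (rule prism_fixed[OF normalized_\<Phi>])
    with fixed show ?thesis by (simp add: map_idI)
  qed
  then have "disc_primitive (Suc J) xs = avg (\<lambda>_. disc_primitive J xs) (projections J)"
    by (auto intro: avg_cong)
  then show ?thesis by (simp add: avg_const finite_projections projections_nonempty)
qed

lemma disc_primitive_stable:
  assumes "xs \<in> tuples (disc I) m" "I \<le> J"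
  shows "disc_primitive J xs = disc_primitive I xs"
  using assms(2)
proof (induction J rule: dec_induct)
  case (step J)
  then have "xs \<in> tuples (disc J) m"
    using assms(1) tuples_mono[OF disc_mono] by blast
  with step disc_primitive_Suc_eq show ?case by simp
qed simp

lemma disc_primitive_degenerate: "disc_primitive J (x # x # xs) = 0"
  by (induction J arbitrary: x xs)
    (simp_all del: prism_simps add: prism_degenerate[OF normalized_\<Phi>])

lemma prism_bounded:
  obtains B where "B \<ge> 0"
    "\<And>J Y xs. Y \<in> projections J \<Longrightarrow> xs \<in> tuples (disc (Suc J)) n \<Longrightarrow> diam_le D xs \<Longrightarrow> \<bar>prism Y \<Phi> xs\<bar> \<le> B"
proof -
  obtain B where B: "B \<ge> 0"
    "\<And>ys. ys \<in> tuples X (Suc n) \<Longrightarrow> diam_le (D + 2 * (width + \<delta>)) ys \<Longrightarrow> \<bar>\<Phi> ys\<bar> \<le> B"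
    using controlledE[OF controlled_\<Phi>] by blast
  have "\<bar>prism Y \<Phi> xs\<bar> \<le> n * B"
    if "Y \<in> projections J" "xs \<in> tuples (disc (Suc J)) n" "diam_le D xs" for J Y xs
  proof -
    have "length xs = n" using that(2) by (simp add: tuples_iff)
    with abs_prism_le[of Y xs \<Phi> B] show ?thesis
      using B(2) projection_diam_le[OF that] prism_simplices_in_tuples by metis
  qed
  with B(1) show ?thesis by (intro that[of "n * B"]) auto
qed

definition disc_primitive_bounded_on :: "(nat \<Rightarrow> 'a list set) \<Rightarrow> bool" where
  "disc_primitive_bounded_on T \<longleftrightarrow> (\<exists>C. \<forall>J. \<forall>xs\<in>T J. \<bar>disc_primitive J xs\<bar> \<le> C)"

definition annulus :: "nat \<Rightarrow> nat \<Rightarrow> nat \<Rightarrow> 'a list set" where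
  "annulus k D J =
    {xs \<in> tuples (disc J) n. diam_le D xs \<and> (\<forall>x\<in>set xs. width * J \<le> d base x + width * k)}"

lemma annulus_mono: "D \<le> E \<Longrightarrow> annulus k D J \<subseteq> annulus k E J"
  by (auto simp: annulus_def intro: diam_le_mono)

lemma annulus_0_iff:
  "xs \<in> annulus 0 D J \<longleftrightarrow> xs \<in> tuples X n \<and> diam_le D xs \<and> (\<forall>x\<in>set xs. d base x = width * J)"
  by (auto simp: annulus_def tuples_iff disc_def intro!: antisym)

lemma disc_primitive_bounded_on_pullback:
  assumes T: "disc_primitive_bounded_on T"
    and T': "\<And>J. T' J \<subseteq> {xs \<in> tuples (disc J) n. diam_le D xs}"
    and pullback: "\<And>J Y xs. xs \<in> T' (Suc J) \<Longrightarrow> Y \<in> projections J \<Longrightarrow> map Y xs \<in> T J"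
  shows "disc_primitive_bounded_on T'"
proof -
  obtain C where C: "\<And>J xs. xs \<in> T J \<Longrightarrow> \<bar>disc_primitive J xs\<bar> \<le> C"
    using T by (auto simp: disc_primitive_bounded_on_def)
  obtain B where B: "B \<ge> 0" "\<And>J Y xs. Y \<in> projections J \<Longrightarrow> xs \<in> tuples (disc (Suc J)) n \<Longrightarrow>
      diam_le D xs \<Longrightarrow> \<bar>prism Y \<Phi> xs\<bar> \<le> B"
    using prism_bounded by blast
  have "\<bar>disc_primitive J xs\<bar> \<le> \<bar>C\<bar> + B" if xs: "xs \<in> T' J" for J xs
  proof (cases J)
    case 0
    then show ?thesis using B(1) by simp
  next
    case (Suc I)
    have "\<bar>disc_primitive I (map Y xs) - prism Y \<Phi> xs\<bar> \<le> \<bar>C\<bar> + B" if Y: "Y \<in> projections I" for Y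
    proof -
      have "\<bar>disc_primitive I (map Y xs)\<bar> \<le> C" using C pullback xs Suc Y by blast
      moreover have "\<bar>prism Y \<Phi> xs\<bar> \<le> B" using B(2) Y xs T' Suc by blast
      ultimately show ?thesis by linarith
    qed
    then show ?thesis
      using Suc B(1) by (simp add: abs_avg_le[OF finite_projections])
  qed
  then show ?thesis by (auto simp: disc_primitive_bounded_on_def)
qed

lemma map_projection_in_annulus:
  assumes "xs \<in> annulus (Suc k) D (Suc J)" "Y \<in> projections J"
  shows "map Y xs \<in> annulus k (D + 2 * (width + \<delta>)) J"
proof -
  have xs: "xs \<in> tuples (disc (Suc J)) n" "diam_le D xs"
    using assms(1) by (auto simp: annulus_def)
  have "map Y xs \<in> tuples (disc J) n"
    using xs(1) projection_in_disc[OF assms(2)] by (auto intro: map_in_tuples)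
  moreover have "diam_le (D + 2 * (width + \<delta>)) (map Y xs)"
    using projection_diam_le(2)[OF assms(2) xs] by (auto simp: tuples_iff)
  moreover have "width * J \<le> d base (Y x) + width * k" if "x \<in> set xs" for x
  proof -
    have x: "x \<in> disc (Suc J)" using that xs(1) by (auto simp: tuples_iff)
    then have "d base (Y x) = min (d base x) (width * J)"
      using projection_in_shadow[OF assms(2)] shadow_radius disc_subset by blast
    moreover have "width * Suc J \<le> d base x + width * Suc k"
      using assms(1) that by (auto simp: annulus_def)
    ultimately show ?thesis by (auto simp: min_def)
  qed
  ultimately show ?thesis by (simp add: annulus_def)
qed

lemma map_projection_in_sphere:
  assumes "xs \<in> annulus 0 D (Suc J)" "Y \<in> projections J"
    and "max (3 * \<delta>) (D + 2 * \<delta> - 2 * width) \<le> E"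
  shows "map Y xs \<in> annulus 0 E J"
proof -
  have xs: "xs \<in> tuples X n" "diam_le D xs" "\<And>x. x \<in> set xs \<Longrightarrow> d base x = width * Suc J"
    using assms(1) by (auto simp: annulus_0_iff)
  have x: "x \<in> X" "Y x \<in> shadow J x" if "x \<in> set xs" for x
    using that xs projection_in_shadow[OF assms(2), of x] by (auto simp: tuples_iff disc_def)
  have "diam_le E (map Y xs)"
    unfolding diam_le_def set_map ball_simps
  proof (intro ballI)
    fix x x' assume xx': "x \<in> set xs" "x' \<in> set xs"
    then have "d (Y x) (Y x') \<le> max (3 * \<delta>) (d x x' + 2 * \<delta> - 2 * width)"
      using x xs(3) by (intro shadow_contracts) auto
    moreover have "d x x' \<le> D" using xs(2) xx' by (rule diam_leD)
    ultimately show "d (Y x) (Y x') \<le> E" using assms(3) by linarith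
  qed
  moreover have "Y x \<in> X" "d base (Y x) = width * J" if "x \<in> set xs" for x
    using sphere_shadow(1,2)[OF x(1) xs(3) x(2)] that by auto
  ultimately show ?thesis
    using xs(1) by (auto simp: annulus_0_iff tuples_iff)
qed

text \<open>Two vertices of a small simplex are projected to the same point with probability at least
  \<open>1 / N\<^sup>2\<close>, and \<open>disc_primitive\<close> vanishes on degenerate simplices.\<close>

lemma avg_disc_primitive_contracts:
  assumes xs: "xs \<in> annulus 0 (3 * \<delta>) (Suc J)"
    and N: "N > 0" "\<And>x. x \<in> disc (Suc J) \<Longrightarrow> card (shadow J x) \<le> N"
    and M: "M \<ge> 0" "\<And>Y. Y \<in> projections J \<Longrightarrow> \<bar>disc_primitive J (map Y xs)\<bar> \<le> M"
  shows "\<bar>avg (\<lambda>Y. disc_primitive J (map Y xs)) (projections J)\<bar> \<le> M - M / (N * N)"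
proof -
  obtain x x' zs where x: "xs = x # x' # zs" "x \<in> X" "x' \<in> X"
    using xs tuple_Cons_ConsE[of xs X n] by (auto simp: annulus_0_iff)
  with xs have radius: "d base x = width * Suc J" "d base x' = width * Suc J" and "d x x' \<le> 3 * \<delta>"
    by (auto simp: annulus_0_iff diam_le_def)
  with x obtain y where y: "y \<in> shadow J x" "y \<in> shadow J x'"
    using shadows_meet by blast
  have disc: "x \<in> disc (Suc J)" "x' \<in> disc (Suc J)"
    using x radius by (auto simp: disc_def)
  let ?Z = "{Y \<in> projections J. disc_primitive J (map Y xs) = 0}"
  have "card (projections J) \<le> card {Y \<in> projections J. Y x = Y x'} * (N * N)"
    using disc y N(2) by (intro card_projections_le_coinciding)
  also have "\<dots> \<le> card ?Z * (N * N)"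
    using finite_projections disc_primitive_degenerate
    by (intro mult_le_mono1 card_mono) (auto simp: x(1))
  finally show ?thesis
    using abs_avg_le_of_vanishing[OF finite_projections M(2), where N = "N * N"] N(1) M(1) by simp
qed

lemma disc_primitive_bounded_on_small_sphere: "disc_primitive_bounded_on (annulus 0 (3 * \<delta>))"
proof -
  obtain N where N: "N > 0" "\<And>J x. x \<in> disc (Suc J) \<Longrightarrow> card (shadow J x) \<le> N"
    using card_shadow_bounded by blast
  obtain B where B: "B \<ge> 0" "\<And>J Y xs. Y \<in> projections J \<Longrightarrow> xs \<in> tuples (disc (Suc J)) n \<Longrightarrow>
      diam_le (3 * \<delta>) xs \<Longrightarrow> \<bar>prism Y \<Phi> xs\<bar> \<le> B"
    using prism_bounded by blast
  define M where "M = real (N * N) * B"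
  have M: "M \<ge> 0" "M / real (N * N) = B" using N(1) B(1) by (simp_all add: M_def)
  have "\<bar>disc_primitive J xs\<bar> \<le> M" if "xs \<in> annulus 0 (3 * \<delta>) J" for J xs
    using that
  proof (induction J arbitrary: xs)
    case 0
    then show ?case using M(1) by simp
  next
    case (Suc J)
    have "\<bar>avg (\<lambda>Y. disc_primitive J (map Y xs)) (projections J)\<bar> \<le> M - M / (N * N)"
    proof (rule avg_disc_primitive_contracts[OF Suc.prems N M(1)])
      fix Y assume "Y \<in> projections J"
      then show "\<bar>disc_primitive J (map Y xs)\<bar> \<le> M"
        using Suc.prems by (intro Suc.IH map_projection_in_sphere) (auto simp: width_def)
    qed
    moreover have "\<bar>avg (\<lambda>Y. prism Y \<Phi> xs) (projections J)\<bar> \<le> B"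
      using B Suc.prems by (intro abs_avg_le finite_projections) (auto simp: annulus_def)
    ultimately show ?case using M(2) by (simp add: avg_diff)
  qed
  then show ?thesis by (auto simp: disc_primitive_bounded_on_def)
qed

lemma disc_primitive_bounded_on_sphere: "disc_primitive_bounded_on (annulus 0 (3 * \<delta> + D))"
proof (induction D)
  case 0
  then show ?case using disc_primitive_bounded_on_small_sphere by simp
next
  case (Suc D)
  then show ?case
  proof (rule disc_primitive_bounded_on_pullback)
    show "annulus 0 (3 * \<delta> + Suc D) J \<subseteq> {xs \<in> tuples (disc J) n. diam_le (3 * \<delta> + Suc D) xs}" for J
      by (auto simp: annulus_def)
    show "map Y xs \<in> annulus 0 (3 * \<delta> + D) J"
      if "xs \<in> annulus 0 (3 * \<delta> + Suc D) (Suc J)" "Y \<in> projections J" for J Y xs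
      using that by (rule map_projection_in_sphere) (simp add: width_def)
  qed
qed

lemma disc_primitive_bounded_on_annulus: "disc_primitive_bounded_on (annulus k D)"
proof (induction k arbitrary: D)
  case 0
  have "annulus 0 D J \<subseteq> annulus 0 (3 * \<delta> + D) J" for J by (simp add: annulus_mono)
  with disc_primitive_bounded_on_sphere[of D] show ?case
    unfolding disc_primitive_bounded_on_def by (meson subsetD)
next
  case (Suc k)
  show ?case
  proof (rule disc_primitive_bounded_on_pullback)
    show "disc_primitive_bounded_on (annulus k (D + 2 * (width + \<delta>)))" by (rule Suc.IH)
    show "annulus (Suc k) D J \<subseteq> {xs \<in> tuples (disc J) n. diam_le D xs}" for J
      by (auto simp: annulus_def)
  qed (rule map_projection_in_annulus)
qed

lemma in_annulus:
  assumes "xs \<in> tuples (disc (Suc J)) n" "xs \<notin> tuples (disc J) n" "diam_le D xs"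
  shows "xs \<in> annulus (Suc D) D (Suc J)"
proof -
  have xs: "x \<in> X" if "x \<in> set xs" for x
    using that assms(1) disc_subset by (auto simp: tuples_iff)
  obtain x where x: "x \<in> set xs" "d base x > width * J"
    using assms(1,2) xs by (fastforce simp: tuples_iff disc_def)
  have "width * Suc J \<le> d base y + width * Suc D" if y: "y \<in> set xs" for y
  proof -
    have "d base x \<le> d base y + d y x"
      using dist_triangle base_in x(1) y xs by blast
    also have "d y x \<le> D" using assms(3) y x(1) by (rule diam_leD)
    also have "D \<le> width * D" by (simp add: width_def)
    finally show ?thesis using x(2) by simp
  qed
  with assms show ?thesis by (simp add: annulus_def)
qed

definition level :: "'a list \<Rightarrow> nat" where
  "level xs = (LEAST J. xs \<in> tuples (disc J) (length xs))"

lemma tuple_in_disc_level: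
  assumes "xs \<in> tuples X m"
  shows "xs \<in> tuples (disc (level xs)) m"
proof -
  have "length xs = m" using assms by (simp add: tuples_iff)
  then show ?thesis
    unfolding level_def using LeastI_ex[OF tuple_in_disc[OF assms]] by simp
qed

lemma level_le: "xs \<in> tuples (disc J) m \<Longrightarrow> level xs \<le> J"
  unfolding level_def by (rule Least_le) (simp add: tuples_iff)

definition limit_primitive :: "'a list \<Rightarrow> real" where
  "limit_primitive xs = disc_primitive (level xs) xs"

lemma limit_primitive_eq:
  assumes "xs \<in> tuples (disc J) m"
  shows "limit_primitive xs = disc_primitive J xs"
proof -
  have "xs \<in> tuples X m" using assms tuples_mono[OF disc_subset] by blast
  then have "disc_primitive J xs = disc_primitive (level xs) xs"
    using level_le[OF assms] by (rule disc_primitive_stable[OF tuple_in_disc_level])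
  then show ?thesis by (simp only: limit_primitive_def)
qed

lemma cobd_limit_primitive:
  assumes "xs \<in> tuples X (Suc n)"
  shows "cobd limit_primitive xs = \<Phi> xs"
proof -
  obtain J where J: "xs \<in> tuples (disc J) (Suc n)" using tuple_in_disc assms by blast
  then have "cobd limit_primitive xs = cobd (disc_primitive J) xs"
    by (intro cobd_cong limit_primitive_eq) (rule faces_in_tuples)
  with J show ?thesis by (simp add: cobd_disc_primitive)
qed

lemma controlled_limit_primitive: "controlled n limit_primitive"
  unfolding controlled_def
proof
  fix D
  obtain C where C: "\<And>J xs. xs \<in> annulus (Suc D) D J \<Longrightarrow> \<bar>disc_primitive J xs\<bar> \<le> C"
    using disc_primitive_bounded_on_annulus[of "Suc D" D]
    unfolding disc_primitive_bounded_on_def by blast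
  have "\<bar>limit_primitive xs\<bar> \<le> \<bar>C\<bar>" if xs: "xs \<in> tuples X n" "diam_le D xs" for xs
  proof (cases "level xs")
    case 0
    then show ?thesis by (simp add: limit_primitive_def)
  next
    case (Suc J)
    then have "xs \<notin> tuples (disc J) n" using level_le[of xs J n] by auto
    then have "xs \<in> annulus (Suc D) D (level xs)"
      using in_annulus tuple_in_disc_level[OF xs(1)] xs(2) Suc by simp
    from C[OF this] show ?thesis by (simp add: limit_primitive_def)
  qed
  then show "\<exists>B. \<forall>xs\<in>tuples X n. diam_le D xs \<longrightarrow> \<bar>limit_primitive xs\<bar> \<le> B" by blast
qed

end

text \<open>A real primitive \<open>R\<close> of \<open>F\<close> satisfies \<open>R = F (x, \<cdot>) + cobd (R (x, \<cdot>))\<close>; rounding \<open>R (x, \<cdot>)\<close>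
  makes the right-hand side integral and changes it by a bounded amount.\<close>

lemma rounded_primitive:
  fixes F :: "'a list \<Rightarrow> int"
  assumes "cobd R (x # xs) = real_of_int (F (x # xs))"
  shows "real_of_int (F (x # xs) + cobd (\<lambda>ys. \<lfloor>R (x # ys)\<rfloor>) xs) =
    R xs - cobd (\<lambda>ys. frac (R (x # ys))) xs"
  using assms by (simp add: frac_def cobd_diff cobd_of_int)

context hyperbolic_space
begin

lemma integral_primitive_of_real:
  fixes F :: "'a list \<Rightarrow> int"
  assumes closed: "\<And>xs. xs \<in> tuples X (Suc (Suc n)) \<Longrightarrow> cobd F xs = 0"
    and R: "\<And>xs. xs \<in> tuples X (Suc n) \<Longrightarrow> cobd R xs = real_of_int (F xs)" "controlled n R"
  obtains Q :: "'a list \<Rightarrow> int"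
  where "\<And>xs. xs \<in> tuples X (Suc n) \<Longrightarrow> cobd Q xs = F xs" "controlled n Q"
proof
  let ?Q = "\<lambda>xs. F (base # xs) + cobd (\<lambda>ys. \<lfloor>R (base # ys)\<rfloor>) xs"
  show "cobd ?Q xs = F xs" if "xs \<in> tuples X (Suc n)" for xs
    using closed[of "base # xs"] that base_in by (simp add: cobd_add cobd_cobd)
  show "controlled n ?Q"
    unfolding controlled_def
  proof
    fix D
    obtain B where B: "\<And>xs. xs \<in> tuples X n \<Longrightarrow> diam_le D xs \<Longrightarrow> \<bar>R xs\<bar> \<le> B"
      using controlledE[OF R(2)] by blast
    have "\<bar>?Q xs\<bar> \<le> \<lceil>B + n\<rceil>" if xs: "xs \<in> tuples X n" "diam_le D xs" for xs
    proof -
      have "\<bar>cobd (\<lambda>ys. frac (R (base # ys))) xs\<bar> \<le> length xs * (1 :: real)"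
        by (rule abs_cobd_le) (simp add: frac_lt_1 less_imp_le)
      moreover have "real_of_int (?Q xs) = R xs - cobd (\<lambda>ys. frac (R (base # ys))) xs"
        using xs(1) base_in by (intro rounded_primitive R(1)) simp
      ultimately have "\<bar>real_of_int (?Q xs)\<bar> \<le> B + n"
        using B[OF xs] xs(1) by (simp add: tuples_iff)
      then show ?thesis by linarith
    qed
    then show "\<exists>B. \<forall>xs\<in>tuples X n. diam_le D xs \<longrightarrow> \<bar>?Q xs\<bar> \<le> B" by blast
  qed
qed

theorem bounded_integral_primitive:
  fixes F :: "'a list \<Rightarrow> int"
  assumes "n \<ge> 2" "normalized F" "controlled (Suc n) F"
    and closed: "\<And>xs. xs \<in> tuples X (Suc (Suc n)) \<Longrightarrow> cobd F xs = 0"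
  obtains Q :: "'a list \<Rightarrow> int"
  where "\<And>xs. xs \<in> tuples X (Suc n) \<Longrightarrow> cobd Q xs = F xs" "controlled n Q"
proof -
  interpret controlled_cocycle X d base \<delta> n "\<lambda>xs. real_of_int (F xs)"
  proof
    show "normalized (\<lambda>xs. real_of_int (F xs))"
      using assms(2) by (simp add: normalized_def)
    show "controlled (Suc n) (\<lambda>xs. real_of_int (F xs))"
      using assms(3) unfolding controlled_def of_int_abs[symmetric]
      by (metis of_int_le_iff)
  qed (simp_all add: assms cobd_of_int)
  show ?thesis
    by (rule integral_primitive_of_real[OF closed
        cobd_limit_primitive controlled_limit_primitive that])
qed

end

section \<open>Word metrics\<close>

lemma (in group) inv_mult_cancel_left:
  assumes "g \<in> carrier G" "x \<in> carrier G"
  shows "inv g \<otimes> (g \<otimes> x) = x" "g \<otimes> (inv g \<otimes> x) = x"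
  using assms by (simp_all add: m_assoc[symmetric])

locale word_metric = group G for G :: "'g monoid" (structure) +
  fixes S :: "'g set"
  assumes finite_S: "finite S"
    and S_carrier: "S \<subseteq> carrier G"
    and generate_S: "generate G S = carrier G"
begin

abbreviation letters :: "'g set" where "letters \<equiv> S \<union> m_inv G ` S"

definition word_value :: "'g list \<Rightarrow> 'g" where "word_value ws = foldr (\<otimes>) ws \<one>"

lemma word_value_simps [simp]:
  "word_value [] = \<one>"
  "word_value (w # ws) = w \<otimes> word_value ws"
  by (simp_all add: word_value_def)

abbreviation len :: "'g \<Rightarrow> nat" where "len \<equiv> word_length G S"

definition wdist :: "'g \<Rightarrow> 'g \<Rightarrow> nat" where "wdist x y = len (inv x \<otimes> y)"

lemma letters_carrier: "letters \<subseteq> carrier G"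
  using S_carrier by auto

lemma inv_letter: "t \<in> letters \<Longrightarrow> inv t \<in> letters"
  using S_carrier by auto

lemma inv_word: "set ws \<subseteq> letters \<Longrightarrow> set (rev (map (m_inv G) ws)) \<subseteq> letters"
  using inv_letter by (simp only: set_rev set_map image_subset_iff subset_iff simp_thms) blast

lemma word_value_closed: "set ws \<subseteq> letters \<Longrightarrow> word_value ws \<in> carrier G"
  using letters_carrier by (induction ws) auto

lemma word_value_append:
  "set vs \<subseteq> letters \<Longrightarrow> set ws \<subseteq> letters \<Longrightarrow> word_value (vs @ ws) = word_value vs \<otimes> word_value ws"
proof (induction vs)
  case Nil
  then show ?case using word_value_closed by simp
next
  case (Cons v vs)
  moreover have "v \<in> carrier G" using Cons.prems letters_carrier by auto
  ultimately show ?case using word_value_closed by (simp add: m_assoc)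
qed

lemma word_value_inv:
  "set ws \<subseteq> letters \<Longrightarrow> word_value (rev (map (m_inv G) ws)) = inv (word_value ws)"
proof (induction ws)
  case (Cons w ws)
  have w: "w \<in> carrier G" "inv w \<in> letters" using Cons.prems letters_carrier inv_letter by auto
  have "word_value (rev (map (m_inv G) ws) @ [inv w]) =
      word_value (rev (map (m_inv G) ws)) \<otimes> word_value [inv w]"
    using w Cons.prems by (intro word_value_append inv_word) auto
  then show ?case
    using Cons w word_value_closed[of ws] by (simp add: inv_mult_group)
qed simp

lemma ex_word: "x \<in> carrier G \<Longrightarrow> \<exists>ws. set ws \<subseteq> letters \<and> word_value ws = x"
  unfolding generate_S[symmetric]
proof (induction rule: generate.induct)
  case one
  show ?case by (intro exI[of _ "[]"]) auto
next
  case (incl h)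
  then show ?case using S_carrier by (intro exI[of _ "[h]"]) auto
next
  case (inv h)
  then show ?case using S_carrier by (intro exI[of _ "[inv h]"]) auto
next
  case (eng h1 h2)
  then obtain vs ws where "set vs \<subseteq> letters" "word_value vs = h1"
      "set ws \<subseteq> letters" "word_value ws = h2"
    by blast
  then show ?case using word_value_append by (intro exI[of _ "vs @ ws"]) auto
qed

lemma shortest_word:
  assumes "x \<in> carrier G"
  obtains ws where "length ws = len x" "set ws \<subseteq> letters" "word_value ws = x"
proof -
  have "\<exists>n ws. length ws = n \<and> set ws \<subseteq> letters \<and> word_value ws = x"
    using ex_word[OF assms] by blast
  from LeastI_ex[OF this] show ?thesis
    using that unfolding word_length_def word_value_def by blast
qed

lemma len_word_value_le: "set ws \<subseteq> letters \<Longrightarrow> len (word_value ws) \<le> length ws"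
  unfolding word_length_def word_value_def by (rule Least_le) blast

lemma len_eq_0_iff: "x \<in> carrier G \<Longrightarrow> len x = 0 \<longleftrightarrow> x = \<one>"
  using len_word_value_le[of "[]"] by (auto elim: shortest_word)

lemma len_mult_le:
  assumes "x \<in> carrier G" "y \<in> carrier G"
  shows "len (x \<otimes> y) \<le> len x + len y"
proof -
  obtain vs ws where "length vs = len x" "set vs \<subseteq> letters" "word_value vs = x"
      "length ws = len y" "set ws \<subseteq> letters" "word_value ws = y"
    using shortest_word assms by metis
  then show ?thesis using len_word_value_le[of "vs @ ws"] word_value_append by simp
qed

lemma len_inv:
  assumes "x \<in> carrier G"
  shows "len (inv x) = len x"
proof -
  have le: "len (inv x) \<le> len x" if "x \<in> carrier G" for x
  proof -
    obtain ws where "length ws = len x" "set ws \<subseteq> letters" "word_value ws = x"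
      using shortest_word \<open>x \<in> carrier G\<close> by blast
    then show ?thesis using len_word_value_le[OF inv_word, of ws] word_value_inv by simp
  qed
  show ?thesis using le[OF assms] le[of "inv x"] assms by simp
qed

lemma finite_len_le: "finite {x \<in> carrier G. len x \<le> r}"
proof (rule finite_subset)
  show "{x \<in> carrier G. len x \<le> r} \<subseteq> word_value ` {ws. set ws \<subseteq> letters \<and> length ws \<le> r}"
  proof
    fix x assume x: "x \<in> {x \<in> carrier G. len x \<le> r}"
    then obtain ws where "length ws = len x" "set ws \<subseteq> letters" "word_value ws = x"
      using shortest_word by blast
    then show "x \<in> word_value ` {ws. set ws \<subseteq> letters \<and> length ws \<le> r}" using x by force
  qed
  show "finite (word_value ` {ws. set ws \<subseteq> letters \<and> length ws \<le> r})"
    using finite_S by (intro finite_imageI finite_lists_length_le) auto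
qed

lemma wdist_left_invariant:
  "g \<in> carrier G \<Longrightarrow> x \<in> carrier G \<Longrightarrow> y \<in> carrier G \<Longrightarrow> wdist (g \<otimes> x) (g \<otimes> y) = wdist x y"
  by (simp add: wdist_def inv_mult_group m_assoc inv_mult_cancel_left)

lemma wdist_one: "x \<in> carrier G \<Longrightarrow> wdist \<one> x = len x"
  by (simp add: wdist_def)

sublocale nat_metric "carrier G" wdist
proof
  fix x y assume xy: "x \<in> carrier G" "y \<in> carrier G"
  have "inv x \<otimes> y = \<one> \<longleftrightarrow> x = y"
    using xy inv_solve_left[of \<one> x y] by auto
  with xy show "wdist x y = 0 \<longleftrightarrow> x = y"
    by (simp add: wdist_def len_eq_0_iff)
  show "wdist x y = wdist y x"
    using len_inv[of "inv x \<otimes> y"] xy by (simp add: wdist_def inv_mult_group)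
  fix z assume z: "z \<in> carrier G"
  have "inv x \<otimes> z = (inv x \<otimes> y) \<otimes> (inv y \<otimes> z)"
    using xy z by (simp add: m_assoc inv_mult_cancel_left)
  then show "wdist x z \<le> wdist x y + wdist y z"
    using len_mult_le xy z by (simp add: wdist_def)
qed

lemma wdist_geodesic_to_one:
  assumes "x \<in> carrier G" "m \<le> len x"
  shows "\<exists>y\<in>carrier G. len y = m \<and> wdist x y = len x - m"
proof -
  obtain ws where ws: "length ws = len x" "set ws \<subseteq> letters" "word_value ws = x"
    using shortest_word assms by blast
  define y z where "y = word_value (take m ws)" and "z = word_value (drop m ws)"
  have sub: "set (take m ws) \<subseteq> letters" "set (drop m ws) \<subseteq> letters"
    using ws(2) set_take_subset set_drop_subset by fastforce+
  have yz: "y \<in> carrier G" "z \<in> carrier G" using sub word_value_closed by (auto simp: y_def z_def)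
  have x: "x = y \<otimes> z" using word_value_append[OF sub] ws(3) by (simp add: y_def z_def)
  have "len y \<le> m" using len_word_value_le[OF sub(1)] assms(2) ws by (simp add: y_def)
  moreover have "len z \<le> len x - m" using len_word_value_le[OF sub(2)] ws by (simp add: z_def)
  moreover have "len x \<le> len y + len z" using len_mult_le yz x by simp
  ultimately have "len y = m" "len z = len x - m" using assms(2) by auto
  moreover have "inv x \<otimes> y = inv z"
    using yz x by (simp add: inv_mult_group m_assoc inv_mult_cancel_left)
  then have "wdist x y = len z" using yz by (simp add: wdist_def len_inv)
  ultimately show ?thesis using yz(1) by (intro bexI[of _ y]) simp_all
qed

lemma wdist_ball:
  assumes "x \<in> carrier G"
  shows "{y \<in> carrier G. wdist x y \<le> r} = (\<otimes>) x ` {y \<in> carrier G. len y \<le> r}"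
proof (intro equalityI subsetI)
  fix y assume y: "y \<in> {y \<in> carrier G. wdist x y \<le> r}"
  then have "y = x \<otimes> (inv x \<otimes> y)" using assms by (simp add: inv_mult_cancel_left)
  with y assms show "y \<in> (\<otimes>) x ` {y \<in> carrier G. len y \<le> r}"
    by (intro image_eqI[of _ _ "inv x \<otimes> y"]) (auto simp: wdist_def)
qed (use assms in \<open>auto simp: wdist_def inv_mult_cancel_left\<close>)

end

locale hyperbolic_word_metric = word_metric G S
  for G :: "'g monoid" (structure) and S :: "'g set" +
  fixes r :: real
  assumes r_nonneg: "r \<ge> 0"
    and gromov: "w \<in> carrier G \<Longrightarrow> x \<in> carrier G \<Longrightarrow> y \<in> carrier G \<Longrightarrow> z \<in> carrier G \<Longrightarrow>
      gromov_product G S w x z \<ge> min (gromov_product G S w x y) (gromov_product G S w y z) - r"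
begin

lemma four_point_inequality:
  assumes "x \<in> carrier G" "y \<in> carrier G" "z \<in> carrier G"
  shows "wdist x z + wdist \<one> y \<le> max (wdist x y + wdist \<one> z) (wdist y z + wdist \<one> x) + nat \<lceil>2 * r\<rceil>"
proof -
  have wdist: "word_dist G S u v = real (wdist u v)" for u v
    by (simp add: word_dist_def wdist_def)
  have sym: "wdist x \<one> = wdist \<one> x" "wdist y \<one> = wdist \<one> y" "wdist z \<one> = wdist \<one> z"
    using assms dist_sym by simp_all
  have "real (wdist x z) + real (wdist \<one> y)
      \<le> max (real (wdist x y) + real (wdist \<one> z)) (real (wdist y z) + real (wdist \<one> x)) + 2 * r"
    using gromov[OF one_closed assms]
    unfolding gromov_product_def wdist sym add_divide_distrib diff_divide_distrib by linarith
  moreover have "2 * r \<le> real (nat \<lceil>2 * r\<rceil>)" using r_nonneg by linarith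
  ultimately have "real (wdist x z + wdist \<one> y)
      \<le> real (max (wdist x y + wdist \<one> z) (wdist y z + wdist \<one> x) + nat \<lceil>2 * r\<rceil>)"
    by (simp add: of_nat_max)
  then show ?thesis by (simp only: of_nat_le_iff)
qed

sublocale hyperbolic_space "carrier G" wdist \<one> "nat \<lceil>2 * r\<rceil>"
proof
  fix x m assume "x \<in> carrier G" "m \<le> wdist \<one> x"
  then show "\<exists>y\<in>carrier G. wdist \<one> y = m \<and> wdist x y = wdist \<one> x - m"
    using wdist_geodesic_to_one[of x m] wdist_one by auto
next
  fix s
  have "finite {y \<in> carrier G. wdist x y \<le> s}"
    "card {y \<in> carrier G. wdist x y \<le> s} \<le> card {y \<in> carrier G. len y \<le> s}" if "x \<in> carrier G" for x
    unfolding wdist_ball[OF that] using finite_len_le by (simp_all add: card_image_le)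
  then show "\<exists>N. \<forall>x\<in>carrier G. finite {y \<in> carrier G. wdist x y \<le> s} \<and>
      card {y \<in> carrier G. wdist x y \<le> s} \<le> N"
    by blast
qed (simp_all add: four_point_inequality)

end

section \<open>Free abelian groups\<close>

type_synonym 'a frag = "'a \<Rightarrow>\<^sub>0 int"

definition frags :: "'a set \<Rightarrow> 'a frag set" where
  "frags A = {f. Poly_Mapping.keys f \<subseteq> A}"

lemma zero_in_frags: "0 \<in> frags A"
  by (simp add: frags_def)

lemma frag_of_in_frags: "x \<in> A \<Longrightarrow> frag_of x \<in> frags A"
  by (simp add: frags_def)

lemma diff_in_frags: "f \<in> frags A \<Longrightarrow> g \<in> frags A \<Longrightarrow> f - g \<in> frags A"
  using keys_diff[of f g] by (auto simp: frags_def)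

lemma cmul_in_frags: "f \<in> frags A \<Longrightarrow> frag_cmul a f \<in> frags A"
  using keys_cmul[of a f] by (auto simp: frags_def)

lemma alternating_sum_in_frags: "(\<And>f. f \<in> set fs \<Longrightarrow> f \<in> frags A) \<Longrightarrow> alternating_sum fs \<in> frags A"
  by (induction fs) (auto intro: zero_in_frags diff_in_frags)

lemma cobd_in_frags:
  assumes "xs \<in> tuples X (Suc n)" "\<And>ys. ys \<in> tuples X n \<Longrightarrow> P ys \<in> frags A"
  shows "cobd P xs \<in> frags A"
  unfolding cobd_def using assms(2) faces_in_tuples[OF assms(1)]
  by (intro alternating_sum_in_frags) auto

lemma additive_frag_extend: "additive (frag_extend b)"
  by (simp add: additive_def frag_extend_add)

lemma frag_extend_in_frags:
  assumes "f \<in> frags A" "\<And>x. x \<in> A \<Longrightarrow> b x \<in> frags B"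
  shows "frag_extend b f \<in> frags B"
  using keys_frag_extend[of b f] assms by (fastforce simp: frags_def)

lemma frag_extend_cong:
  "f \<in> frags A \<Longrightarrow> (\<And>x. x \<in> A \<Longrightarrow> b x = b' x) \<Longrightarrow> frag_extend b f = frag_extend b' f"
  by (intro frag_extend_eq) (auto simp: frags_def)

lemma frag_extend_extend:
  "frag_extend a (frag_extend b f) = frag_extend (\<lambda>x. frag_extend a (b x)) f"
  using subset_UNIV by (induction f rule: frag_induction) (simp_all add: frag_extend_diff)

lemma frag_extend_diff_left: "frag_extend (\<lambda>x. a x - b x) f = frag_extend a f - frag_extend b f"
  using subset_UNIV by (induction f rule: frag_induction) (simp_all add: frag_extend_diff)

definition frag_map :: "('a \<Rightarrow> 'b) \<Rightarrow> 'a frag \<Rightarrow> 'b frag" where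
  "frag_map h = frag_extend (\<lambda>x. frag_of (h x))"

lemma frag_map_of [simp]: "frag_map h (frag_of x) = frag_of (h x)"
  by (simp add: frag_map_def)

lemma frag_map_zero [simp]: "frag_map h 0 = 0"
  by (simp add: frag_map_def)

lemma frag_map_diff: "frag_map h (f - g) = frag_map h f - frag_map h g"
  by (simp add: frag_map_def frag_extend_diff)

lemma additive_frag_map: "additive (frag_map h)"
  by (simp add: frag_map_def additive_frag_extend)

lemma frag_map_in_frags:
  "f \<in> frags A \<Longrightarrow> (\<And>x. x \<in> A \<Longrightarrow> h x \<in> B) \<Longrightarrow> frag_map h f \<in> frags B"
  unfolding frag_map_def by (rule frag_extend_in_frags) (auto intro: frag_of_in_frags)

lemma frag_map_cong: "f \<in> frags A \<Longrightarrow> (\<And>x. x \<in> A \<Longrightarrow> h x = h' x) \<Longrightarrow> frag_map h f = frag_map h' f"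
  unfolding frag_map_def by (rule frag_extend_cong) auto

lemma frag_map_ident: "frag_map (\<lambda>x. x) f = f"
  unfolding frag_map_def by (rule frag_expansion[symmetric])

lemma frag_extend_frag_map: "frag_extend b (frag_map h f) = frag_extend (\<lambda>x. b (h x)) f"
  by (simp add: frag_map_def frag_extend_extend)

lemma frag_map_frag_extend: "frag_map h (frag_extend b f) = frag_extend (\<lambda>x. frag_map h (b x)) f"
  by (simp add: frag_map_def frag_extend_extend)

lemma frag_map_frag_map: "frag_map h (frag_map h' f) = frag_map (\<lambda>x. h (h' x)) f"
  by (simp add: frag_map_def frag_extend_extend)

definition frag_eval :: "('a \<Rightarrow> int) \<Rightarrow> 'a frag \<Rightarrow> int" where
  "frag_eval \<phi> f = (\<Sum>x\<in>Poly_Mapping.keys f. Poly_Mapping.lookup f x * \<phi> x)"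

lemma frag_eval_superset:
  "finite A \<Longrightarrow> f \<in> frags A \<Longrightarrow> frag_eval \<phi> f = (\<Sum>x\<in>A. Poly_Mapping.lookup f x * \<phi> x)"
  unfolding frag_eval_def by (intro sum.mono_neutral_left) (auto simp: frags_def in_keys_iff)

lemma additive_frag_eval: "additive (frag_eval \<phi>)"
proof
  fix f g :: "'a frag"
  let ?A = "Poly_Mapping.keys f \<union> Poly_Mapping.keys g"
  have "f \<in> frags ?A" "g \<in> frags ?A" "f + g \<in> frags ?A"
    using keys_add[of f g] by (auto simp: frags_def)
  then show "frag_eval \<phi> (f + g) = frag_eval \<phi> f + frag_eval \<phi> g"
    by (simp add: frag_eval_superset[of ?A] lookup_add distrib_right sum.distrib)
qed

lemma frag_eval_zero [simp]: "frag_eval \<phi> 0 = 0"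
  by (simp add: frag_eval_def)

lemma frag_eval_of [simp]: "frag_eval \<phi> (frag_of x) = \<phi> x"
  by (simp add: frag_eval_def)

lemma frag_eval_diff: "frag_eval \<phi> (f - g) = frag_eval \<phi> f - frag_eval \<phi> g"
  by (rule additive.diff[OF additive_frag_eval])

lemma frag_eval_cmul: "frag_eval \<phi> (frag_cmul a f) = a * frag_eval \<phi> f"
  using frag_eval_superset[of "Poly_Mapping.keys f" "frag_cmul a f" \<phi>] keys_cmul[of a f]
  by (simp add: frag_eval_def frags_def sum_distrib_left mult.assoc)

lemma frag_eval_diff_left: "frag_eval (\<lambda>x. \<phi> x - \<psi> x) f = frag_eval \<phi> f - frag_eval \<psi> f"
  by (simp add: frag_eval_def right_diff_distrib sum_subtractf)

lemma frag_eval_cong: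
  "f \<in> frags A \<Longrightarrow> (\<And>x. x \<in> A \<Longrightarrow> \<phi> x = \<psi> x) \<Longrightarrow> frag_eval \<phi> f = frag_eval \<psi> f"
  unfolding frag_eval_def frags_def by (intro sum.cong) auto

lemma frag_eval_frag_extend: "frag_eval \<phi> (frag_extend b f) = frag_eval (\<lambda>x. frag_eval \<phi> (b x)) f"
  using subset_UNIV
  by (induction f rule: frag_induction) (simp_all add: frag_extend_diff frag_eval_diff)

lemma frag_eval_frag_map: "frag_eval \<phi> (frag_map h f) = frag_eval (\<lambda>x. \<phi> (h x)) f"
  by (simp add: frag_map_def frag_eval_frag_extend)

lemma lookup_frag_extend:
  "Poly_Mapping.lookup (frag_extend b f) y = frag_eval (\<lambda>x. Poly_Mapping.lookup (b x) y) f"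
  using subset_UNIV
  by (induction f rule: frag_induction) (simp_all add: frag_extend_diff frag_eval_diff lookup_minus)

lemma abs_frag_eval_le:
  assumes "f \<in> frags A" "\<And>x. x \<in> A \<Longrightarrow> \<bar>\<phi> x\<bar> \<le> B"
  shows "\<bar>frag_eval \<phi> f\<bar> \<le> (\<Sum>x\<in>Poly_Mapping.keys f. \<bar>Poly_Mapping.lookup f x\<bar>) * B"
proof -
  have "\<bar>frag_eval \<phi> f\<bar> \<le> (\<Sum>x\<in>Poly_Mapping.keys f. \<bar>Poly_Mapping.lookup f x * \<phi> x\<bar>)"
    unfolding frag_eval_def by (rule sum_abs)
  also have "\<dots> \<le> (\<Sum>x\<in>Poly_Mapping.keys f. \<bar>Poly_Mapping.lookup f x\<bar> * B)"
    using assms by (intro sum_mono) (auto simp: abs_mult frags_def intro!: mult_left_mono)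
  finally show ?thesis by (simp add: sum_distrib_right)
qed

definition bar_boundary :: "'a list frag \<Rightarrow> 'a list frag" where
  "bar_boundary = frag_extend (cobd frag_of)"

lemma frag_extend_bar_boundary: "frag_extend P (bar_boundary z) = frag_extend (cobd P) z"
  unfolding bar_boundary_def frag_extend_extend
  by (simp add: cobd_additive[OF additive_frag_extend, symmetric])

lemma frag_eval_bar_boundary: "frag_eval P (bar_boundary z) = frag_eval (cobd P) z"
  unfolding bar_boundary_def frag_eval_frag_extend
  by (simp add: cobd_additive[OF additive_frag_eval, symmetric])

lemma bar_boundary_cone: "bar_boundary (frag_map ((#) x) z) = z - frag_map ((#) x) (bar_boundary z)"
proof -
  have "cobd (\<lambda>ys. frag_of (x # ys)) = (\<lambda>ys. frag_map ((#) x) (cobd frag_of ys))"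
    using cobd_additive[OF additive_frag_map, of "(#) x" frag_of] by (simp add: fun_eq_iff)
  then have "bar_boundary (frag_map ((#) x) z) =
      frag_extend (\<lambda>ys. frag_of ys - frag_map ((#) x) (cobd frag_of ys)) z"
    by (simp add: bar_boundary_def frag_extend_frag_map)
  then show ?thesis
    by (simp add: frag_extend_diff_left bar_boundary_def frag_map_frag_extend
        frag_expansion[symmetric])
qed

section \<open>Equivariant maps\<close>

lemma uniform_bound_finite:
  fixes f :: "'a \<Rightarrow> 'b \<Rightarrow> 'c::linordered_idom"
  assumes "finite A" "\<And>x. x \<in> A \<Longrightarrow> \<exists>B. \<forall>y\<in>Y. \<bar>f x y\<bar> \<le> B"
  shows "\<exists>B. \<forall>x\<in>A. \<forall>y\<in>Y. \<bar>f x y\<bar> \<le> B"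
  using assms
proof (induction A)
  case (insert x A)
  then obtain B B' where "\<forall>x\<in>A. \<forall>y\<in>Y. \<bar>f x y\<bar> \<le> B" "\<forall>y\<in>Y. \<bar>f x y\<bar> \<le> B'"
    by (metis insertI1 insertI2)
  then have "\<forall>x\<in>insert x A. \<forall>y\<in>Y. \<bar>f x y\<bar> \<le> max B B'"
    by (auto intro: max.coboundedI1 max.coboundedI2)
  then show ?case ..
qed simp

context group
begin

definition equivariant ::
  "'x set \<Rightarrow> ('a \<Rightarrow> 'x \<Rightarrow> 'x) \<Rightarrow> ('a \<Rightarrow> 'y \<Rightarrow> 'y) \<Rightarrow> ('x \<Rightarrow> 'y frag) \<Rightarrow> bool" where
  "equivariant A \<rho> \<sigma> f \<longleftrightarrow> (\<forall>g\<in>carrier G. \<forall>x\<in>A. f (\<rho> g x) = frag_map (\<sigma> g) (f x))"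

lemma equivariantD:
  "equivariant A \<rho> \<sigma> f \<Longrightarrow> g \<in> carrier G \<Longrightarrow> x \<in> A \<Longrightarrow> f (\<rho> g x) = frag_map (\<sigma> g) (f x)"
  by (simp add: equivariant_def)

lemma equivariant_diff:
  "equivariant A \<rho> \<sigma> f \<Longrightarrow> equivariant A \<rho> \<sigma> h \<Longrightarrow> equivariant A \<rho> \<sigma> (\<lambda>x. f x - h x)"
  by (simp add: equivariant_def frag_map_diff)

lemma frag_extend_equivariantD:
  assumes "equivariant A \<rho> \<sigma> b" "f \<in> frags A" "g \<in> carrier G"
  shows "frag_extend b (frag_map (\<rho> g) f) = frag_map (\<sigma> g) (frag_extend b f)"
  unfolding frag_extend_frag_map frag_map_frag_extend
  using assms by (intro frag_extend_cong[OF assms(2)]) (rule equivariantD)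

lemma equivariant_frag_extend:
  assumes "equivariant A \<rho> \<sigma> f" "\<And>x. x \<in> A \<Longrightarrow> f x \<in> frags B" "equivariant B \<sigma> \<tau> b"
  shows "equivariant A \<rho> \<tau> (\<lambda>x. frag_extend b (f x))"
  using assms(1,2) frag_extend_equivariantD[OF assms(3)] by (simp add: equivariant_def)

lemma frag_eval_orbit_bounded:
  assumes "f \<in> frags B" "\<And>y. y \<in> B \<Longrightarrow> \<exists>b. \<forall>g\<in>carrier G. \<bar>\<phi> (\<sigma> g y)\<bar> \<le> b"
  shows "\<exists>b. \<forall>g\<in>carrier G. \<bar>frag_eval \<phi> (frag_map (\<sigma> g) f)\<bar> \<le> b"
proof -
  let ?K = "Poly_Mapping.keys f"
  have "\<exists>b. \<forall>y\<in>?K. \<forall>g\<in>carrier G. \<bar>\<phi> (\<sigma> g y)\<bar> \<le> b"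
    using assms by (intro uniform_bound_finite) (auto simp: frags_def)
  then obtain b where "\<And>y g. y \<in> ?K \<Longrightarrow> g \<in> carrier G \<Longrightarrow> \<bar>\<phi> (\<sigma> g y)\<bar> \<le> b" by blast
  then have "\<bar>frag_eval \<phi> (frag_map (\<sigma> g) f)\<bar> \<le> (\<Sum>x\<in>?K. \<bar>Poly_Mapping.lookup f x\<bar>) * b"
    if "g \<in> carrier G" for g
    unfolding frag_eval_frag_map using that
    by (intro abs_frag_eval_le[of f ?K]) (auto simp: frags_def)
  then show ?thesis by blast
qed

lemma equivariant_frag_eval_bounded:
  assumes f: "equivariant A \<rho> \<sigma> f" "\<And>x. x \<in> A \<Longrightarrow> f x \<in> frags B"
    and \<phi>: "\<And>y. y \<in> B \<Longrightarrow> \<exists>b. \<forall>g\<in>carrier G. \<bar>\<phi> (\<sigma> g y)\<bar> \<le> b"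
    and R: "finite R" "R \<subseteq> A"
  shows "\<exists>b. \<forall>x\<in>R. \<forall>g\<in>carrier G. \<bar>frag_eval \<phi> (f (\<rho> g x))\<bar> \<le> b"
proof (rule uniform_bound_finite[OF R(1)])
  fix x assume "x \<in> R"
  then have "x \<in> A" using R(2) by blast
  then show "\<exists>b. \<forall>g\<in>carrier G. \<bar>frag_eval \<phi> (f (\<rho> g x))\<bar> \<le> b"
    using frag_eval_orbit_bounded[of "f x" B \<phi> \<sigma>] f \<phi> equivariantD[OF f(1)] by auto
qed

lemma equivariant_frag_of: "equivariant A \<rho> \<rho> frag_of"
  by (simp add: equivariant_def)

end

locale cellular_group = group G for G :: "'g monoid" (structure)
begin

definition cells :: "nat \<Rightarrow> ('g \<times> nat) set" where
  "cells r = carrier G \<times> {..<r}"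

definition shift :: "'g \<Rightarrow> 'g \<times> nat \<Rightarrow> 'g \<times> nat" where
  "shift g c = (g \<otimes> fst c, snd c)"

lemma cells_iff: "c \<in> cells r \<longleftrightarrow> fst c \<in> carrier G \<and> snd c < r"
  by (cases c) (simp add: cells_def)

lemma fst_shift [simp]: "fst (shift g c) = g \<otimes> fst c"
  and snd_shift [simp]: "snd (shift g c) = snd c"
  by (simp_all add: shift_def)

lemma shift_in_cells [intro]: "g \<in> carrier G \<Longrightarrow> c \<in> cells r \<Longrightarrow> shift g c \<in> cells r"
  by (auto simp: cells_iff)

lemma shift_shift:
  "g \<in> carrier G \<Longrightarrow> h \<in> carrier G \<Longrightarrow> c \<in> cells r \<Longrightarrow> shift g (shift h c) = shift (g \<otimes> h) c"
  by (simp add: shift_def cells_iff m_assoc)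

lemma shift_one: "c \<in> cells r \<Longrightarrow> shift \<one> c = c"
  by (simp add: shift_def cells_iff)

lemma ball_cells_iff: "(\<forall>c\<in>cells r. P c) \<longleftrightarrow> (\<forall>g\<in>carrier G. \<forall>j<r. P (g, j))"
  by (auto simp: cells_def)

lemma bounded_cochain_iff: "bounded_cochain G k m \<phi> \<longleftrightarrow> (\<exists>B. \<forall>c\<in>cells (k m). \<bar>\<phi> c\<bar> \<le> B)"
  by (simp add: bounded_cochain_def ball_cells_iff)

lemma bounded_cochain_diff:
  assumes "bounded_cochain G k m \<phi>" "bounded_cochain G k m \<psi>"
  shows "bounded_cochain G k m (\<lambda>c. \<phi> c - \<psi> c)"
proof -
  obtain B B' where B: "\<And>c. c \<in> cells (k m) \<Longrightarrow> \<bar>\<phi> c\<bar> \<le> B" "\<And>c. c \<in> cells (k m) \<Longrightarrow> \<bar>\<psi> c\<bar> \<le> B'"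
    using assms unfolding bounded_cochain_iff by blast
  have "\<bar>\<phi> c - \<psi> c\<bar> \<le> B + B'" if "c \<in> cells (k m)" for c
    using B[OF that] by linarith
  then show ?thesis unfolding bounded_cochain_iff by blast
qed

lemma bounded_cochain_on_orbits:
  assumes "bounded_cochain G k m \<phi>" "c \<in> cells (k m)"
  shows "\<exists>b. \<forall>g\<in>carrier G. \<bar>\<phi> (shift g c)\<bar> \<le> b"
  using assms unfolding bounded_cochain_iff by blast

lemma bounded_cochain_frag_eval:
  assumes "equivariant (cells (k m)) shift \<sigma> f" "\<And>c. c \<in> cells (k m) \<Longrightarrow> f c \<in> frags B"
    and "\<And>y. y \<in> B \<Longrightarrow> \<exists>b. \<forall>g\<in>carrier G. \<bar>\<phi> (\<sigma> g y)\<bar> \<le> b"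
  shows "bounded_cochain G k m (\<lambda>c. frag_eval \<phi> (f c))"
proof -
  let ?R = "{\<one>} \<times> {..<k m}"
  have "finite ?R" "?R \<subseteq> cells (k m)" by (auto simp: cells_def)
  then obtain b where b: "\<And>c g. c \<in> ?R \<Longrightarrow> g \<in> carrier G \<Longrightarrow> \<bar>frag_eval \<phi> (f (shift g c))\<bar> \<le> b"
    using equivariant_frag_eval_bounded[OF assms, of ?R] by blast
  have "\<bar>frag_eval \<phi> (f c)\<bar> \<le> b" if "c \<in> cells (k m)" for c
  proof -
    have "shift (fst c) (\<one>, snd c) = c" using that by (simp add: shift_def cells_iff)
    then show ?thesis using b[of "(\<one>, snd c)" "fst c"] that by (simp add: cells_iff)
  qed
  then show ?thesis unfolding bounded_cochain_iff by blast
qed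

abbreviation act :: "'g \<Rightarrow> ('g \<times> nat) frag \<Rightarrow> ('g \<times> nat) frag" where
  "act g \<equiv> frag_map (shift g)"

lemma act_in_frags: "g \<in> carrier G \<Longrightarrow> f \<in> frags (cells r) \<Longrightarrow> act g f \<in> frags (cells r)"
  by (rule frag_map_in_frags) auto

lemma act_act:
  "g \<in> carrier G \<Longrightarrow> h \<in> carrier G \<Longrightarrow> f \<in> frags (cells r) \<Longrightarrow> act g (act h f) = act (g \<otimes> h) f"
  unfolding frag_map_frag_map by (rule frag_map_cong) (auto simp: shift_shift)

lemma act_one: "f \<in> frags (cells r) \<Longrightarrow> act \<one> f = f"
  using frag_map_cong[of f "cells r" "shift \<one>" "\<lambda>x. x"] shift_one by (simp add: frag_map_ident)

definition orbit_extension :: "(nat \<Rightarrow> ('g \<times> nat) frag) \<Rightarrow> 'g \<times> nat \<Rightarrow> ('g \<times> nat) frag" where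
  "orbit_extension b c = act (fst c) (b (snd c))"

lemma orbit_extension_in_frags:
  assumes "\<And>j. j < r \<Longrightarrow> b j \<in> frags (cells s)" "c \<in> cells r"
  shows "orbit_extension b c \<in> frags (cells s)"
  using assms by (auto simp: orbit_extension_def cells_iff intro: act_in_frags)

lemma orbit_extension_equivariant:
  assumes "\<And>j. j < r \<Longrightarrow> b j \<in> frags (cells s)"
  shows "equivariant (cells r) shift shift (orbit_extension b)"
  using assms act_act by (fastforce simp: equivariant_def orbit_extension_def cells_iff)

end

section \<open>Free resolutions of finite type\<close>

locale free_resolution = cellular_group G for G :: "'g monoid" (structure) +
  fixes k :: "nat \<Rightarrow> nat" and bd :: "nat \<Rightarrow> nat \<Rightarrow> ('g \<times> nat) frag" and eps :: "nat \<Rightarrow> int"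
  assumes bd_in_frags: "j < k (Suc m) \<Longrightarrow> bd (Suc m) j \<in> frags (cells (k m))"
    and augmentation_onto: "\<exists>f\<in>frags (cells (k 0)). frag_eval (\<lambda>c. eps (snd c)) f = 1"
    and exact_augmentation: "f \<in> frags (cells (k 0)) \<Longrightarrow> frag_eval (\<lambda>c. eps (snd c)) f = 0 \<longleftrightarrow>
      (\<exists>z\<in>frags (cells (k 1)). frag_extend (orbit_extension (bd 1)) z = f)"
    and exact_boundary: "f \<in> frags (cells (k (Suc m))) \<Longrightarrow>
      frag_extend (orbit_extension (bd (Suc m))) f = 0 \<longleftrightarrow>
      (\<exists>z\<in>frags (cells (k (Suc (Suc m)))). frag_extend (orbit_extension (bd (Suc (Suc m)))) z = f)"
begin

abbreviation chain_group :: "nat \<Rightarrow> ('g \<times> nat) frag set" where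
  "chain_group m \<equiv> frags (cells (k m))"

abbreviation boundary :: "nat \<Rightarrow> 'g \<times> nat \<Rightarrow> ('g \<times> nat) frag" where
  "boundary m \<equiv> orbit_extension (bd m)"

abbreviation augmentation :: "('g \<times> nat) frag \<Rightarrow> int" where
  "augmentation \<equiv> frag_eval (\<lambda>c. eps (snd c))"

definition cycles :: "nat \<Rightarrow> ('g \<times> nat) frag set" where
  "cycles m =
    {f \<in> chain_group m. if m = 0 then augmentation f = 0 else frag_extend (boundary m) f = 0}"

lemma boundary_in_chain_group: "c \<in> cells (k (Suc m)) \<Longrightarrow> boundary (Suc m) c \<in> chain_group m"
  using bd_in_frags by (rule orbit_extension_in_frags)

lemma boundary_equivariant: "equivariant (cells (k (Suc m))) shift shift (boundary (Suc m))"
  using bd_in_frags by (rule orbit_extension_equivariant)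

lemma cycles_iff:
  "f \<in> cycles m \<longleftrightarrow>
    f \<in> chain_group m \<and> (\<exists>z\<in>chain_group (Suc m). frag_extend (boundary (Suc m)) z = f)"
  using exact_augmentation exact_boundary by (cases m) (auto simp: cycles_def)

lemma boundary_in_cycles: "c \<in> cells (k (Suc m)) \<Longrightarrow> boundary (Suc m) c \<in> cycles m"
  using frag_extend_of[of "boundary (Suc m)" c]
  by (auto simp: cycles_iff boundary_in_chain_group simp del: frag_extend_of
      intro: frag_of_in_frags)

lemma augmentation_boundary: "c \<in> cells (k 1) \<Longrightarrow> augmentation (boundary 1 c) = 0"
  using boundary_in_cycles[of c 0] by (simp add: cycles_def)

lemma boundary_boundary:
  "c \<in> cells (k (Suc (Suc m))) \<Longrightarrow> frag_extend (boundary (Suc m)) (boundary (Suc (Suc m)) c) = 0"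
  using boundary_in_cycles[of c "Suc m"] by (simp add: cycles_def)

lemma augmentation_act: "augmentation (act g f) = augmentation f"
  by (simp add: frag_eval_frag_map)

lemma act_in_cycles: "g \<in> carrier G \<Longrightarrow> f \<in> cycles m \<Longrightarrow> act g f \<in> cycles m"
  using frag_extend_equivariantD[OF boundary_equivariant, of f]
  by (cases m) (auto simp: cycles_def augmentation_act act_in_frags)

text \<open>Sending \<open>0\<close> to \<open>0\<close> is what makes the comparison map from the bar complex vanish on degenerate
  simplices; moving a cycle to the identity before filling it makes \<open>filling\<close> equivariant although
  \<open>choose_filling\<close> is not.\<close>

definition choose_filling :: "nat \<Rightarrow> ('g \<times> nat) frag \<Rightarrow> ('g \<times> nat) frag" where
  "choose_filling m f = (if f = 0 then 0
     else SOME z. z \<in> chain_group (Suc m) \<and> frag_extend (boundary (Suc m)) z = f)"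

definition filling :: "nat \<Rightarrow> 'g \<Rightarrow> ('g \<times> nat) frag \<Rightarrow> ('g \<times> nat) frag" where
  "filling m g f = act g (choose_filling m (act (inv g) f))"

lemma filling_zero [simp]: "filling m g 0 = 0"
  by (simp add: filling_def choose_filling_def)

lemma choose_filling:
  assumes "f \<in> cycles m"
  shows "choose_filling m f \<in> chain_group (Suc m)"
    and "frag_extend (boundary (Suc m)) (choose_filling m f) = f"
proof -
  have "\<exists>z. z \<in> chain_group (Suc m) \<and> frag_extend (boundary (Suc m)) z = f"
    using assms cycles_iff by blast
  from someI_ex[OF this] show "choose_filling m f \<in> chain_group (Suc m)"
    and "frag_extend (boundary (Suc m)) (choose_filling m f) = f"
    by (auto simp: choose_filling_def zero_in_frags)
qed

lemma filling:
  assumes "f \<in> cycles m" "g \<in> carrier G"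
  shows "filling m g f \<in> chain_group (Suc m)"
    and "frag_extend (boundary (Suc m)) (filling m g f) = f"
proof -
  have "act (inv g) f \<in> cycles m" using assms by (simp add: act_in_cycles)
  note z = choose_filling[OF this]
  show "filling m g f \<in> chain_group (Suc m)"
    unfolding filling_def using assms(2) z(1) by (rule act_in_frags)
  have "f \<in> chain_group m" using assms(1) by (simp add: cycles_def)
  then have "act g (act (inv g) f) = f" using assms(2) by (simp add: act_act act_one)
  then show "frag_extend (boundary (Suc m)) (filling m g f) = f"
    unfolding filling_def frag_extend_equivariantD[OF boundary_equivariant z(1) assms(2)] z(2) .
qed

lemma filling_act:
  assumes "f \<in> cycles m" "g \<in> carrier G" "h \<in> carrier G"
  shows "filling m (h \<otimes> g) (act h f) = act h (filling m g f)"
proof -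
  have f: "f \<in> chain_group m" using assms(1) by (simp add: cycles_def)
  have "inv (h \<otimes> g) \<otimes> h = inv g" using assms by (simp add: inv_mult_group m_assoc)
  then have "act (inv (h \<otimes> g)) (act h f) = act (inv g) f"
    using assms f by (simp add: act_act)
  moreover have "choose_filling m (act (inv g) f) \<in> chain_group (Suc m)"
    using assms by (intro choose_filling act_in_cycles) auto
  ultimately show ?thesis
    using assms by (simp add: filling_def act_act)
qed

end

section \<open>Null-homotopies\<close>

locale augmentation_zero_chain_map = free_resolution G k bd eps
  for G :: "'g monoid" (structure) and k bd eps +
  fixes \<tau> :: "nat \<Rightarrow> 'g \<times> nat \<Rightarrow> ('g \<times> nat) frag"
  assumes \<tau>_in_chain_group: "c \<in> cells (k m) \<Longrightarrow> \<tau> m c \<in> chain_group m"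
    and \<tau>_equivariant: "equivariant (cells (k m)) shift shift (\<tau> m)"
    and augmentation_\<tau>: "c \<in> cells (k 0) \<Longrightarrow> augmentation (\<tau> 0 c) = 0"
    and boundary_\<tau>: "c \<in> cells (k (Suc m)) \<Longrightarrow>
      frag_extend (boundary (Suc m)) (\<tau> (Suc m) c) = frag_extend (\<tau> m) (boundary (Suc m) c)"
begin

primrec null_homotopy :: "nat \<Rightarrow> 'g \<times> nat \<Rightarrow> ('g \<times> nat) frag" where
  "null_homotopy 0 = (\<lambda>c. filling 0 (fst c) (\<tau> 0 c))"
| "null_homotopy (Suc m) = (\<lambda>c. filling (Suc m) (fst c)
     (\<tau> (Suc m) c - frag_extend (null_homotopy m) (boundary (Suc m) c)))"

definition defect :: "nat \<Rightarrow> 'g \<times> nat \<Rightarrow> ('g \<times> nat) frag" where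
  "defect m c = \<tau> m c - (if m = 0 then 0 else frag_extend (null_homotopy (m - 1)) (boundary m c))"

lemma null_homotopy_eq_filling: "null_homotopy m c = filling m (fst c) (defect m c)"
  by (cases m) (simp_all add: defect_def)

lemma defect_in_cycles: "c \<in> cells (k m) \<Longrightarrow> defect m c \<in> cycles m"
proof (induction m arbitrary: c)
  case 0
  then show ?case
    using \<tau>_in_chain_group augmentation_\<tau> by (simp add: defect_def cycles_def)
next
  case (Suc m)
  have homotopy: "null_homotopy m e \<in> chain_group (Suc m)"
      "frag_extend (boundary (Suc m)) (null_homotopy m e) = defect m e"
    if "e \<in> cells (k m)" for e
    using filling[OF Suc.IH[OF that]] that by (simp_all add: null_homotopy_eq_filling cells_iff)
  have boundary_c: "boundary (Suc m) c \<in> chain_group m"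
    using Suc.prems by (rule boundary_in_chain_group)
  have "frag_extend (defect m) (boundary (Suc m) c) = frag_extend (\<tau> m) (boundary (Suc m) c)"
  proof (cases m)
    case (Suc l)
    then show ?thesis
      using boundary_boundary Suc.prems
      by (simp add: defect_def[abs_def] frag_extend_diff_left frag_extend_extend[symmetric])
  qed (simp add: defect_def[abs_def])
  moreover have
    "frag_extend (boundary (Suc m)) (frag_extend (null_homotopy m) (boundary (Suc m) c)) =
      frag_extend (defect m) (boundary (Suc m) c)"
    unfolding frag_extend_extend using boundary_c homotopy(2) by (rule frag_extend_cong)
  moreover have "defect (Suc m) c \<in> chain_group (Suc m)"
    using diff_in_frags[OF \<tau>_in_chain_group[OF Suc.prems]
        frag_extend_in_frags[OF boundary_c homotopy(1)]]
    by (simp add: defect_def)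
  ultimately show ?case
    using boundary_\<tau>[OF Suc.prems] by (simp add: cycles_def defect_def frag_extend_diff)
qed

lemma null_homotopy_in_chain_group: "c \<in> cells (k m) \<Longrightarrow> null_homotopy m c \<in> chain_group (Suc m)"
  and boundary_null_homotopy:
    "c \<in> cells (k m) \<Longrightarrow> frag_extend (boundary (Suc m)) (null_homotopy m c) = defect m c"
  using filling[OF defect_in_cycles] by (simp_all add: null_homotopy_eq_filling cells_iff)

lemma null_homotopy_equivariant: "equivariant (cells (k m)) shift shift (null_homotopy m)"
proof (induction m)
  case 0
  then show ?case
    using defect_in_cycles[of _ 0] equivariantD[OF \<tau>_equivariant]
    by (auto simp: equivariant_def cells_iff defect_def filling_act)
next
  case (Suc m)
  have "equivariant (cells (k (Suc m))) shift shift
      (\<lambda>c. frag_extend (null_homotopy m) (boundary (Suc m) c))"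
    using boundary_equivariant boundary_in_chain_group Suc.IH by (rule equivariant_frag_extend)
  then have "equivariant (cells (k (Suc m))) shift shift (defect (Suc m))"
    using \<tau>_equivariant by (simp add: defect_def[abs_def] equivariant_diff)
  then show ?case
    using defect_in_cycles
    by (simp del: null_homotopy.simps
        add: null_homotopy_eq_filling equivariant_def cells_iff filling_act)
qed

end

section \<open>Comparison with the bar complex\<close>

context free_resolution
begin

definition base_vertex :: "('g \<times> nat) frag" where
  "base_vertex = (SOME f. f \<in> chain_group 0 \<and> augmentation f = 1)"

lemma base_vertex: "base_vertex \<in> chain_group 0" "augmentation base_vertex = 1"
proof -
  have "\<exists>f. f \<in> chain_group 0 \<and> augmentation f = 1"
    using augmentation_onto by blast
  from someI_ex[OF this] show "base_vertex \<in> chain_group 0" "augmentation base_vertex = 1"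
    by (auto simp: base_vertex_def)
qed

abbreviation simplices :: "nat \<Rightarrow> 'g list set" where
  "simplices m \<equiv> tuples (carrier G) (Suc m)"

primrec bar_to_cell :: "nat \<Rightarrow> 'g list \<Rightarrow> ('g \<times> nat) frag" where
  "bar_to_cell 0 = (\<lambda>xs. if length xs = 1 then act (hd xs) base_vertex else 0)"
| "bar_to_cell (Suc m) = (\<lambda>xs. filling m (hd xs) (cobd (bar_to_cell m) xs))"

lemma normalized_bar_to_cell: "normalized (bar_to_cell m)"
proof (induction m)
  case 0
  have "length xs = 1 \<Longrightarrow> distinct_adj xs" for xs :: "'g list"
    by (cases xs) auto
  then show ?case by (auto simp: normalized_def)
next
  case (Suc m)
  then have "normalized (cobd (bar_to_cell m))" by (rule normalized_cobd)
  then show ?case by (simp add: normalized_def)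
qed

lemma hd_simplex: "xs \<in> simplices m \<Longrightarrow> hd xs \<in> carrier G"
  by (elim tuples_SucE) simp

lemma bar_to_cell_vertex:
  assumes "xs \<in> simplices 0"
  shows "bar_to_cell 0 xs \<in> chain_group 0" "augmentation (bar_to_cell 0 xs) = 1"
  using assms base_vertex hd_simplex[OF assms]
  by (simp_all add: tuples_iff augmentation_act act_in_frags)

lemma cobd_bar_to_cell_0_in_cycles:
  assumes "xs \<in> simplices 1"
  shows "cobd (bar_to_cell 0) xs \<in> cycles 0"
proof -
  obtain x y where "xs = [x, y]" "[x] \<in> simplices 0" "[y] \<in> simplices 0"
    using assms by (auto simp: tuples_iff length_Suc_conv)
  then show ?thesis
    using bar_to_cell_vertex
    by (simp del: bar_to_cell.simps add: cycles_def frag_eval_diff diff_in_frags)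
qed

lemma bar_to_cell_cycles:
  "(\<forall>xs\<in>simplices m. bar_to_cell m xs \<in> chain_group m) \<and>
   (\<forall>xs\<in>simplices (Suc m). cobd (bar_to_cell m) xs \<in> cycles m)"
proof (induction m)
  case 0
  show ?case using bar_to_cell_vertex(1) cobd_bar_to_cell_0_in_cycles by simp
next
  case (Suc m)
  then have filled: "bar_to_cell (Suc m) xs \<in> chain_group (Suc m)"
      "frag_extend (boundary (Suc m)) (bar_to_cell (Suc m) xs) = cobd (bar_to_cell m) xs"
    if "xs \<in> simplices (Suc m)" for xs
    using filling[of "cobd (bar_to_cell m) xs" m "hd xs"] that hd_simplex[OF that] by auto
  have "cobd (bar_to_cell (Suc m)) xs \<in> cycles (Suc m)" if xs: "xs \<in> simplices (Suc (Suc m))" for xs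
  proof -
    have "frag_extend (boundary (Suc m)) (cobd (bar_to_cell (Suc m)) xs) =
        cobd (cobd (bar_to_cell m)) xs"
      unfolding cobd_additive[OF additive_frag_extend, symmetric]
      using faces_in_tuples[OF xs] filled(2) by (intro cobd_cong) blast
    then show ?thesis
      using cobd_in_frags[OF xs filled(1)] by (simp add: cycles_def cobd_cobd)
  qed
  with filled(1) show ?case by blast
qed

lemma bar_to_cell_in_chain_group: "xs \<in> simplices m \<Longrightarrow> bar_to_cell m xs \<in> chain_group m"
  and cobd_bar_to_cell_in_cycles: "xs \<in> simplices (Suc m) \<Longrightarrow> cobd (bar_to_cell m) xs \<in> cycles m"
  using bar_to_cell_cycles by blast+

lemma boundary_bar_to_cell:
  "xs \<in> simplices (Suc m) \<Longrightarrow>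
    frag_extend (boundary (Suc m)) (bar_to_cell (Suc m) xs) = cobd (bar_to_cell m) xs"
  by (simp add: filling(2) cobd_bar_to_cell_in_cycles hd_simplex)

abbreviation diagonal :: "'g \<Rightarrow> 'g list \<Rightarrow> 'g list" where
  "diagonal g \<equiv> map ((\<otimes>) g)"

lemma diagonal_in_simplices: "g \<in> carrier G \<Longrightarrow> xs \<in> simplices m \<Longrightarrow> diagonal g xs \<in> simplices m"
  by (rule map_in_tuples) auto

lemma hd_diagonal: "xs \<in> simplices m \<Longrightarrow> hd (diagonal g xs) = g \<otimes> hd xs"
  by (elim tuples_SucE) simp

lemma bar_to_cell_equivariant: "equivariant (simplices m) diagonal shift (bar_to_cell m)"
proof (induction m)
  case 0
  show ?case
    unfolding equivariant_def
  proof (intro ballI)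
    fix g xs assume "g \<in> carrier G" "xs \<in> simplices 0"
    then show "bar_to_cell 0 (diagonal g xs) = act g (bar_to_cell 0 xs)"
      using hd_simplex hd_diagonal act_act base_vertex(1) by (simp add: tuples_iff)
  qed
next
  case (Suc m)
  show ?case
    unfolding equivariant_def
  proof (intro ballI)
    fix g xs assume g: "g \<in> carrier G" and xs: "xs \<in> simplices (Suc m)"
    have "cobd (bar_to_cell m) (diagonal g xs) = cobd (\<lambda>ys. bar_to_cell m (diagonal g ys)) xs"
      by (rule cobd_map[symmetric])
    also have "\<dots> = cobd (\<lambda>ys. act g (bar_to_cell m ys)) xs"
      using Suc.IH g faces_in_tuples[OF xs] by (intro cobd_cong) (rule equivariantD)
    also have "\<dots> = act g (cobd (bar_to_cell m) xs)"
      by (rule cobd_additive[OF additive_frag_map])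
    finally show "bar_to_cell (Suc m) (diagonal g xs) = act g (bar_to_cell (Suc m) xs)"
      using g xs by (simp add: hd_diagonal filling_act cobd_bar_to_cell_in_cycles hd_simplex)
  qed
qed

text \<open>The bar complex is contracted by coning; taking the group element of the cell as the apex
  makes the resulting chain map equivariant.\<close>

primrec cell_to_bar :: "nat \<Rightarrow> 'g \<times> nat \<Rightarrow> 'g list frag" where
  "cell_to_bar 0 = (\<lambda>c. frag_cmul (eps (snd c)) (frag_of [fst c]))"
| "cell_to_bar (Suc m) =
    (\<lambda>c. frag_map ((#) (fst c)) (frag_extend (cell_to_bar m) (boundary (Suc m) c)))"

lemma cell_to_bar_in_frags: "c \<in> cells (k m) \<Longrightarrow> cell_to_bar m c \<in> frags (simplices m)"
proof (induction m arbitrary: c)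
  case 0
  then show ?case
    by (auto simp: cells_iff tuples_iff intro!: cmul_in_frags frag_of_in_frags)
next
  case (Suc m)
  then have "frag_extend (cell_to_bar m) (boundary (Suc m) c) \<in> frags (simplices m)"
    by (intro frag_extend_in_frags[OF boundary_in_chain_group])
  with Suc.prems show ?case by (auto simp: cells_iff intro: frag_map_in_frags)
qed

lemma bar_boundary_cell_to_bar:
  "c \<in> cells (k (Suc m)) \<Longrightarrow>
    bar_boundary (cell_to_bar (Suc m) c) = frag_extend (cell_to_bar m) (boundary (Suc m) c)"
proof (induction m arbitrary: c)
  case 0
  have "bar_boundary (frag_extend (cell_to_bar 0) f) = frag_cmul (augmentation f) (frag_of [])"
    for f
    using subset_UNIV
    by (induction f rule: frag_induction)
      (simp_all add: bar_boundary_def frag_extend_diff frag_extend_cmul frag_eval_diff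
        frag_cmul_diff_distrib)
  with 0 augmentation_boundary show ?case
    by (simp add: bar_boundary_cone)
next
  case (Suc m)
  have "bar_boundary (frag_extend (cell_to_bar (Suc m)) (boundary (Suc (Suc m)) c)) =
      frag_extend (\<lambda>e. bar_boundary (cell_to_bar (Suc m) e)) (boundary (Suc (Suc m)) c)"
    by (simp only: bar_boundary_def frag_extend_extend)
  also have "\<dots> =
      frag_extend (\<lambda>e. frag_extend (cell_to_bar m) (boundary (Suc m) e)) (boundary (Suc (Suc m)) c)"
    using boundary_in_chain_group[OF Suc.prems] Suc.IH by (rule frag_extend_cong)
  also have "\<dots> = 0"
    using boundary_boundary[OF Suc.prems] by (simp add: frag_extend_extend[symmetric])
  finally show ?case
    by (simp only: cell_to_bar.simps(2)[of "Suc m"] bar_boundary_cone) simp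
qed

lemma cell_to_bar_equivariant: "equivariant (cells (k m)) shift diagonal (cell_to_bar m)"
proof (induction m)
  case 0
  show ?case
    by (simp add: equivariant_def frag_map_def frag_extend_cmul)
next
  case (Suc m)
  have "equivariant (cells (k (Suc m))) shift diagonal
      (\<lambda>c. frag_extend (cell_to_bar m) (boundary (Suc m) c))"
    using boundary_equivariant boundary_in_chain_group Suc.IH by (rule equivariant_frag_extend)
  then show ?case
    by (simp add: equivariant_def frag_map_frag_map)
qed

definition round_trip :: "nat \<Rightarrow> 'g \<times> nat \<Rightarrow> ('g \<times> nat) frag" where
  "round_trip m c = frag_extend (bar_to_cell m) (cell_to_bar m c)"

lemma round_trip_in_chain_group: "c \<in> cells (k m) \<Longrightarrow> round_trip m c \<in> chain_group m"
  unfolding round_trip_def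
  by (intro frag_extend_in_frags[OF cell_to_bar_in_frags] bar_to_cell_in_chain_group)

lemma round_trip_equivariant: "equivariant (cells (k m)) shift shift (round_trip m)"
  unfolding round_trip_def[abs_def]
  using cell_to_bar_equivariant cell_to_bar_in_frags bar_to_cell_equivariant
  by (rule equivariant_frag_extend)

lemma augmentation_round_trip:
  assumes "c \<in> cells (k 0)"
  shows "augmentation (round_trip 0 c) = eps (snd c)"
proof -
  have "augmentation (bar_to_cell 0 [fst c]) = 1"
    using assms by (intro bar_to_cell_vertex) (simp add: cells_iff tuples_iff)
  then show ?thesis
    by (simp del: bar_to_cell.simps add: round_trip_def frag_extend_cmul frag_eval_cmul)
qed

lemma boundary_round_trip:
  assumes c: "c \<in> cells (k (Suc m))"
  shows "frag_extend (boundary (Suc m)) (round_trip (Suc m) c) =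
    frag_extend (round_trip m) (boundary (Suc m) c)"
proof -
  have "frag_extend (boundary (Suc m)) (round_trip (Suc m) c) =
      frag_extend (\<lambda>xs. frag_extend (boundary (Suc m)) (bar_to_cell (Suc m) xs))
        (cell_to_bar (Suc m) c)"
    unfolding round_trip_def by (rule frag_extend_extend)
  also have "\<dots> = frag_extend (cobd (bar_to_cell m)) (cell_to_bar (Suc m) c)"
    using cell_to_bar_in_frags[OF c] boundary_bar_to_cell by (rule frag_extend_cong)
  also have "\<dots> = frag_extend (bar_to_cell m) (frag_extend (cell_to_bar m) (boundary (Suc m) c))"
    by (simp only: frag_extend_bar_boundary[symmetric] bar_boundary_cell_to_bar[OF c])
  finally show ?thesis
    by (simp add: frag_extend_extend round_trip_def[abs_def])
qed

end

context free_resolution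
begin

sublocale round_trip: augmentation_zero_chain_map G k bd eps "\<lambda>m c. round_trip m c - frag_of c"
proof
  show "equivariant (cells (k m)) shift shift (\<lambda>c. round_trip m c - frag_of c)" for m
    by (intro equivariant_diff round_trip_equivariant equivariant_frag_of)
qed (simp_all add: round_trip_in_chain_group frag_of_in_frags diff_in_frags frag_eval_diff
    augmentation_round_trip frag_extend_diff boundary_round_trip frag_extend_diff_left
    frag_expansion[symmetric])

definition cell_primitive :: "nat \<Rightarrow> ('g \<times> nat \<Rightarrow> int) \<Rightarrow> ('g list \<Rightarrow> int) \<Rightarrow> 'g \<times> nat \<Rightarrow> int" where
  "cell_primitive m \<phi> Q c =
     frag_eval Q (cell_to_bar m c) - frag_eval \<phi> (round_trip.null_homotopy m c)"

lemma frag_eval_cell_primitive_boundary: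
  assumes c: "c \<in> cells (k (Suc m))"
    and \<phi>: "\<And>e. e \<in> cells (k (Suc (Suc m))) \<Longrightarrow> frag_eval \<phi> (boundary (Suc (Suc m)) e) = 0"
    and Q: "\<And>xs. xs \<in> simplices (Suc m) \<Longrightarrow> cobd Q xs = frag_eval \<phi> (bar_to_cell (Suc m) xs)"
  shows "frag_eval (cell_primitive m \<phi> Q) (boundary (Suc m) c) = \<phi> c"
proof -
  let ?h = "round_trip.null_homotopy"
  have "frag_eval (\<lambda>e. frag_eval Q (cell_to_bar m e)) (boundary (Suc m) c)
      = frag_eval (cobd Q) (cell_to_bar (Suc m) c)"
    by (simp only: frag_eval_frag_extend[symmetric] bar_boundary_cell_to_bar[OF c, symmetric]
        frag_eval_bar_boundary)
  also have "\<dots> = frag_eval \<phi> (round_trip (Suc m) c)"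
    unfolding round_trip_def frag_eval_frag_extend
    using cell_to_bar_in_frags[OF c] Q by (rule frag_eval_cong)
  finally have Q_part: "frag_eval (\<lambda>e. frag_eval Q (cell_to_bar m e)) (boundary (Suc m) c)
      = frag_eval \<phi> (round_trip (Suc m) c)" .
  have "0 = frag_eval \<phi> (frag_extend (boundary (Suc (Suc m))) (?h (Suc m) c))"
    unfolding frag_eval_frag_extend
    using frag_eval_cong[OF round_trip.null_homotopy_in_chain_group[OF c] \<phi>]
    by (simp add: frag_eval_def)
  also have "\<dots> = frag_eval \<phi> (round_trip (Suc m) c) - \<phi> c
      - frag_eval \<phi> (frag_extend (?h m) (boundary (Suc m) c))"
    unfolding round_trip.boundary_null_homotopy[OF c]
    by (simp add: round_trip.defect_def frag_eval_diff)
  finally show ?thesis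
    unfolding cell_primitive_def[abs_def] frag_eval_diff_left Q_part
    by (simp add: frag_eval_frag_extend)
qed

end

section \<open>Bounded cochains on a resolution of a hyperbolic group\<close>

locale hyperbolic_resolution = hyperbolic_word_metric G S r + free_resolution G k bd eps
  for G :: "'g monoid" (structure) and S r k bd eps
begin

lemma diam_le_diagonal:
  assumes "g \<in> carrier G" "set xs \<subseteq> carrier G"
  shows "diam_le D (diagonal g xs) \<longleftrightarrow> diam_le D xs"
  using assms wdist_left_invariant by (simp add: diam_le_def subset_iff)

lemma controlled_bar_pullback:
  assumes "bounded_cochain G k m \<phi>"
  shows "controlled (Suc m) (\<lambda>xs. frag_eval \<phi> (bar_to_cell m xs))"
  unfolding controlled_def
proof
  fix D
  let ?R = "tuples {x \<in> carrier G. len x \<le> D} (Suc m)"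
  have "finite ?R" "?R \<subseteq> simplices m"
    using finite_len_le by (auto intro!: finite_tuples tuples_mono)
  with bar_to_cell_equivariant bar_to_cell_in_chain_group bounded_cochain_on_orbits[OF assms]
  have "\<exists>b. \<forall>xs\<in>?R. \<forall>g\<in>carrier G. \<bar>frag_eval \<phi> (bar_to_cell m (diagonal g xs))\<bar> \<le> b"
    by (rule equivariant_frag_eval_bounded)
  then obtain b where b: "\<And>xs g. xs \<in> ?R \<Longrightarrow> g \<in> carrier G \<Longrightarrow>
      \<bar>frag_eval \<phi> (bar_to_cell m (diagonal g xs))\<bar> \<le> b"
    by blast
  have "\<bar>frag_eval \<phi> (bar_to_cell m xs)\<bar> \<le> b" if xs: "xs \<in> simplices m" "diam_le D xs" for xs
  proof -
    let ?x = "hd xs"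
    have x: "?x \<in> carrier G" using xs(1) by (rule hd_simplex)
    have "?x \<in> set xs" using xs(1) by (elim tuples_SucE) simp
    have "diagonal ?x (diagonal (inv ?x) xs) = xs"
      using xs(1) x by (auto simp: tuples_iff inv_mult_cancel_left intro!: map_idI)
    moreover have "diagonal (inv ?x) xs \<in> ?R"
      using xs x \<open>?x \<in> set xs\<close> by (auto simp: tuples_iff diam_le_def wdist_def)
    ultimately show ?thesis using b[of "diagonal (inv ?x) xs" ?x] x by simp
  qed
  then show "\<exists>b. \<forall>xs\<in>simplices m. diam_le D xs \<longrightarrow> \<bar>frag_eval \<phi> (bar_to_cell m xs)\<bar> \<le> b" by blast
qed

lemma controlled_on_orbits:
  assumes "controlled (Suc m) Q" and xs: "xs \<in> simplices m"
  shows "\<exists>b. \<forall>g\<in>carrier G. \<bar>Q (diagonal g xs)\<bar> \<le> b"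
proof -
  obtain D where D: "diam_le D xs" using ex_diam_le by blast
  obtain b where b: "\<And>ys. ys \<in> simplices m \<Longrightarrow> diam_le D ys \<Longrightarrow> \<bar>Q ys\<bar> \<le> b"
    using controlledE[OF assms(1)] by blast
  have "\<bar>Q (diagonal g xs)\<bar> \<le> b" if "g \<in> carrier G" for g
    using b diagonal_in_simplices[OF that xs] diam_le_diagonal[OF that] D xs
    by (simp add: tuples_iff)
  then show ?thesis by blast
qed

lemma bounded_cell_primitive:
  assumes "bounded_cochain G k (Suc m) \<phi>" "controlled (Suc m) Q"
  shows "bounded_cochain G k m (cell_primitive m \<phi> Q)"
  unfolding cell_primitive_def[abs_def]
proof (rule bounded_cochain_diff)
  show "bounded_cochain G k m (\<lambda>c. frag_eval Q (cell_to_bar m c))"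
    using cell_to_bar_equivariant cell_to_bar_in_frags controlled_on_orbits[OF assms(2)]
    by (rule bounded_cochain_frag_eval)
  show "bounded_cochain G k m (\<lambda>c. frag_eval \<phi> (round_trip.null_homotopy m c))"
    using round_trip.null_homotopy_equivariant round_trip.null_homotopy_in_chain_group
      bounded_cochain_on_orbits[OF assms(1)]
    by (rule bounded_cochain_frag_eval)
qed

theorem bounded_cellular_primitive:
  assumes m: "m \<ge> 1"
    and bounded: "bounded_cochain G k (Suc m) \<phi>"
    and cocycle: "\<And>c. c \<in> cells (k (Suc (Suc m))) \<Longrightarrow> frag_eval \<phi> (boundary (Suc (Suc m)) c) = 0"
  shows "\<exists>\<psi>. bounded_cochain G k m \<psi> \<and>
    (\<forall>c\<in>cells (k (Suc m)). frag_eval \<psi> (boundary (Suc m) c) = \<phi> c)"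
proof -
  let ?F = "\<lambda>xs. frag_eval \<phi> (bar_to_cell (Suc m) xs)"
  have closed: "cobd ?F xs = 0" if xs: "xs \<in> simplices (Suc (Suc m))" for xs
  proof -
    have "cobd ?F xs =
        frag_eval \<phi> (frag_extend (boundary (Suc (Suc m))) (bar_to_cell (Suc (Suc m)) xs))"
      unfolding boundary_bar_to_cell[OF xs] by (rule cobd_additive[OF additive_frag_eval])
    also have "\<dots> = frag_eval (\<lambda>_. 0) (bar_to_cell (Suc (Suc m)) xs)"
      unfolding frag_eval_frag_extend
      using bar_to_cell_in_chain_group[OF xs] cocycle by (rule frag_eval_cong)
    finally show ?thesis by (simp add: frag_eval_def)
  qed
  have normalized: "normalized ?F"
    using normalized_bar_to_cell[of "Suc m"] by (simp del: bar_to_cell.simps add: normalized_def)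
  have controlled: "controlled (Suc (Suc m)) ?F" using bounded by (rule controlled_bar_pullback)
  have "Suc m \<ge> 2" using m by simp
  from bounded_integral_primitive[OF this normalized controlled closed]
  obtain Q where Q: "\<And>xs. xs \<in> simplices (Suc m) \<Longrightarrow> cobd Q xs = ?F xs" "controlled (Suc m) Q"
    by blast
  have "frag_eval (cell_primitive m \<phi> Q) (boundary (Suc m) c) = \<phi> c"
    if "c \<in> cells (k (Suc m))" for c
    using that cocycle Q(1) by (rule frag_eval_cell_primitive_boundary)
  with bounded_cell_primitive[OF bounded Q(2)] show ?thesis by blast
qed

end

section \<open>Chains as finitely supported functions\<close>

context cellular_group
begin

lemma lookup_in_chains_iff: "Poly_Mapping.lookup f \<in> chains G r \<longleftrightarrow> f \<in> frags (cells r)"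
  by (auto simp: chains_def frags_def cells_def in_keys_iff subset_iff)

lemma
  assumes "f \<in> chains G r"
  shows lookup_Abs_chain: "Poly_Mapping.lookup (Abs_poly_mapping f) = f"
    and Abs_chain_in_frags: "Abs_poly_mapping f \<in> frags (cells r)"
proof -
  show "Poly_Mapping.lookup (Abs_poly_mapping f) = f"
    using assms by (simp add: chains_def)
  with assms show "Abs_poly_mapping f \<in> frags (cells r)"
    by (simp flip: lookup_in_chains_iff)
qed

lemma bex_chains_iff: "(\<exists>f\<in>chains G r. P f) \<longleftrightarrow> (\<exists>f\<in>frags (cells r). P (Poly_Mapping.lookup f))"
  by (metis lookup_Abs_chain Abs_chain_in_frags lookup_in_chains_iff)

lemma aug_lookup: "aug eps (Poly_Mapping.lookup f) = frag_eval (\<lambda>c. eps (snd c)) f"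
  by (simp add: aug_def frag_eval_def keys.rep_eq)

lemma lookup_act:
  assumes "g \<in> carrier G" "f \<in> frags (cells r)"
  shows "Poly_Mapping.lookup (act g f) = translate G g (Poly_Mapping.lookup f)"
proof
  fix c :: "'g \<times> nat"
  have "Poly_Mapping.lookup (act g f) c = frag_eval (\<lambda>e. if c = shift g e then 1 else 0) f"
    by (simp add: frag_map_def lookup_frag_extend)
  also have "\<dots> = translate G g (Poly_Mapping.lookup f) c"
  proof (cases "fst c \<in> carrier G")
    case True
    have "frag_eval (\<lambda>e. if c = shift g e then 1 else 0) f =
        frag_eval (\<lambda>e. if e = shift (inv g) c then 1 else 0) f"
      using assms True
      by (intro frag_eval_cong[OF assms(2)]) (auto simp: shift_def cells_iff inv_mult_cancel_left)
    also have "\<dots> = Poly_Mapping.lookup f (shift (inv g) c)"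
      by (simp add: frag_eval_def if_distrib in_keys_iff cong: if_cong)
    finally show ?thesis using True by (simp add: translate_def shift_def split_beta)
  next
    case False
    have "frag_eval (\<lambda>e. if c = shift g e then 1 else 0) f = frag_eval (\<lambda>_. 0) f"
      using assms False by (intro frag_eval_cong[OF assms(2)]) (auto simp: cells_iff)
    then show ?thesis using False by (simp add: translate_def frag_eval_def split_beta)
  qed
  finally show "Poly_Mapping.lookup (act g f) c = translate G g (Poly_Mapping.lookup f) c" .
qed

lemma bdry_lookup:
  assumes d: "\<And>j. j < r \<Longrightarrow> d j \<in> chains G s" and f: "f \<in> frags (cells r)"
  shows "bdry G d (Poly_Mapping.lookup f) =
    Poly_Mapping.lookup (frag_extend (orbit_extension (\<lambda>j. Abs_poly_mapping (d j))) f)"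
proof
  fix x
  have "Poly_Mapping.lookup (orbit_extension (\<lambda>j. Abs_poly_mapping (d j)) c) x =
      translate G (fst c) (d (snd c)) x"
    if "c \<in> cells r" for c
    using that lookup_act[OF _ Abs_chain_in_frags[OF d], of "fst c" "snd c"] lookup_Abs_chain[OF d]
    by (simp add: orbit_extension_def cells_iff)
  then have
    "frag_eval (\<lambda>c. Poly_Mapping.lookup (orbit_extension (\<lambda>j. Abs_poly_mapping (d j)) c) x) f =
      frag_eval (\<lambda>c. translate G (fst c) (d (snd c)) x) f"
    by (rule frag_eval_cong[OF f])
  then show "bdry G d (Poly_Mapping.lookup f) x =
      Poly_Mapping.lookup (frag_extend (orbit_extension (\<lambda>j. Abs_poly_mapping (d j))) f) x"
    by (simp add: lookup_frag_extend bdry_def frag_eval_def keys.rep_eq)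
qed

lemma boundary_in_chains:
  "free_resolution_fin_type G k d eps \<Longrightarrow> j < k (Suc m) \<Longrightarrow> d (Suc m) j \<in> chains G (k m)"
  unfolding free_resolution_fin_type_def by (metis diff_Suc_1 le_add1 plus_1_eq_Suc)

lemma coboundary_eq_frag_eval:
  assumes "free_resolution_fin_type G k d eps" "c \<in> cells (k (Suc n))"
  shows "coboundary G d n \<phi> c =
    frag_eval \<phi> (orbit_extension (\<lambda>j. Abs_poly_mapping (d (Suc n) j)) c)"
proof -
  have "d (Suc n) (snd c) \<in> chains G (k n)"
    using assms by (simp add: boundary_in_chains cells_iff)
  then show ?thesis
    unfolding orbit_extension_def frag_eval_frag_map
    by (simp add: coboundary_def frag_eval_def shift_def keys.rep_eq lookup_Abs_chain split_beta)
qed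

lemma linf_cohomology_vanishes_SucI:
  assumes "free_resolution_fin_type G k d eps"
  defines "boundary \<equiv> \<lambda>n. orbit_extension (\<lambda>j. Abs_poly_mapping (d n j))"
  assumes primitive: "\<And>\<phi>. bounded_cochain G k (Suc m) \<phi> \<Longrightarrow>
      (\<And>c. c \<in> cells (k (Suc (Suc m))) \<Longrightarrow> frag_eval \<phi> (boundary (Suc (Suc m)) c) = 0) \<Longrightarrow>
      \<exists>\<psi>. bounded_cochain G k m \<psi> \<and>
        (\<forall>c\<in>cells (k (Suc m)). frag_eval \<psi> (boundary (Suc m) c) = \<phi> c)"
  shows "linf_cohomology_vanishes G k d (Suc m)"
proof -
  have coboundary: "coboundary G d n \<phi> c = frag_eval \<phi> (boundary (Suc n) c)"
    if "c \<in> cells (k (Suc n))" for n \<phi> c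
    using coboundary_eq_frag_eval[OF assms(1) that] by (simp add: boundary_def)
  show ?thesis
    unfolding linf_cohomology_vanishes_def
  proof (intro allI impI, elim conjE)
    fix \<phi>
    assume "bounded_cochain G k (Suc m) \<phi>"
      and cocycle: "\<forall>g\<in>carrier G. \<forall>j<k (Suc (Suc m)). coboundary G d (Suc m) \<phi> (g, j) = 0"
    moreover have "frag_eval \<phi> (boundary (Suc (Suc m)) c) = 0"
      if "c \<in> cells (k (Suc (Suc m)))" for c
      using cocycle that by (auto simp: coboundary[OF that, symmetric] cells_def)
    ultimately show "\<exists>\<psi>. bounded_cochain G k (Suc m - 1) \<psi> \<and>
        (\<forall>g\<in>carrier G. \<forall>j<k (Suc m). coboundary G d (Suc m - 1) \<psi> (g, j) = \<phi> (g, j))"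
      using primitive[of \<phi>] by (auto simp: coboundary cells_iff)
  qed
qed

lemma free_resolution_Abs_poly_mapping:
  assumes res: "free_resolution_fin_type G k d eps"
  shows "free_resolution G k (\<lambda>m j. Abs_poly_mapping (d m j)) eps"
proof
  note d = boundary_in_chains[OF res]
  have bdry: "bdry G (d (Suc m)) (Poly_Mapping.lookup z) = Poly_Mapping.lookup f \<longleftrightarrow>
      frag_extend (orbit_extension (\<lambda>j. Abs_poly_mapping (d (Suc m) j))) z = f"
    if "z \<in> frags (cells (k (Suc m)))" for m z f
    using bdry_lookup[OF d that] by (simp add: lookup_inject)
  show "Abs_poly_mapping (d (Suc m) j) \<in> frags (cells (k m))" if "j < k (Suc m)" for m j
    using d[OF that] by (rule Abs_chain_in_frags)
  show "\<exists>f\<in>frags (cells (k 0)). frag_eval (\<lambda>c. eps (snd c)) f = 1"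
    using res by (auto simp: free_resolution_fin_type_def bex_chains_iff aug_lookup)
  show "frag_eval (\<lambda>c. eps (snd c)) f = 0 \<longleftrightarrow>
      (\<exists>z\<in>frags (cells (k 1)). frag_extend (orbit_extension (\<lambda>j. Abs_poly_mapping (d 1 j))) z = f)"
    if "f \<in> frags (cells (k 0))" for f
  proof -
    have "aug eps (Poly_Mapping.lookup f) = 0 \<longleftrightarrow>
        (\<exists>c\<in>chains G (k 1). bdry G (d 1) c = Poly_Mapping.lookup f)"
      using res that by (simp add: free_resolution_fin_type_def lookup_in_chains_iff)
    then show ?thesis using bdry[of _ 0 f] by (simp add: aug_lookup bex_chains_iff)
  qed
  show "frag_extend (orbit_extension (\<lambda>j. Abs_poly_mapping (d (Suc m) j))) f = 0 \<longleftrightarrow>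
      (\<exists>z\<in>frags (cells (k (Suc (Suc m)))).
        frag_extend (orbit_extension (\<lambda>j. Abs_poly_mapping (d (Suc (Suc m)) j))) z = f)"
    if f: "f \<in> frags (cells (k (Suc m)))" for m f
  proof -
    have "bdry G (d (Suc m)) (Poly_Mapping.lookup f) = (\<lambda>_. 0) \<longleftrightarrow>
        (\<exists>c\<in>chains G (k (Suc (Suc m))). bdry G (d (Suc (Suc m))) c = Poly_Mapping.lookup f)"
      using res f by (simp add: free_resolution_fin_type_def lookup_in_chains_iff)
    moreover have "(\<lambda>_. 0) = Poly_Mapping.lookup (0 :: ('g \<times> nat) frag)"
      by (simp add: fun_eq_iff)
    ultimately show ?thesis
      using bdry[OF f, of 0] bdry[of _ "Suc m" f] by (simp add: bex_chains_iff)
  qed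
qed

end

theorem theorem2p3:
  fixes G :: "'g monoid"
    and k :: "nat \<Rightarrow> nat"
    and d :: "nat \<Rightarrow> nat \<Rightarrow> ('g \<times> nat \<Rightarrow> int)"
    and eps :: "nat \<Rightarrow> int"
    and i :: nat
  assumes "hyperbolic_group G"
    and "free_resolution_fin_type G k d eps"
    and "i > 1"
  shows "linf_cohomology_vanishes G k d i"
proof -
  obtain S r where "hyperbolic_word_metric G S r"
    using assms(1) unfolding hyperbolic_group_def hyperbolic_word_metric_def
      hyperbolic_word_metric_axioms_def word_metric_def word_metric_axioms_def by blast
  then interpret hyperbolic_word_metric G S r .
  interpret cellular_group G ..
  interpret free_resolution G k "\<lambda>m j. Abs_poly_mapping (d m j)" eps
    using assms(2) by (rule free_resolution_Abs_poly_mapping)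
  interpret hyperbolic_resolution G S r k "\<lambda>m j. Abs_poly_mapping (d m j)" eps ..
  obtain m where i: "i = Suc m" "m \<ge> 1" using assms(3) by (cases i) auto
  show ?thesis
    unfolding i(1) using assms(2) bounded_cellular_primitive[OF i(2)]
    by (rule linf_cohomology_vanishes_SucI)
qed

end
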